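(* Consider a distributed storage system (DSS) with $n$ noncolluding databases that uses an $[n,k]$ MDS-PIR capacity-achieving code $\mathscr{C}$ over $\mathbb{F}_q$ to store $f$ messages, and let the $\mu$ candidate functions be the linear functions given by the rows of a matrix $V\in\mathbb{F}_q^{\mu\times f}$ (all rows nonzero) of rank $r$. Then the private linear computation (PLC) capacity $\mathsf{C}_{\mathrm{PLC}}$, i.e., the maximum achievable PLC rate over all possible PLC protocols, satisfies $$\mathsf{C}_{\mathrm{PLC}}\le\frac{1}{1+\sum_{v=1}^{r-1}\left(\frac{k}{n}\right)^{v}}=\left(1-\frac{k}{n}\right)\left[1-\left(\frac{k}{n}\right)^{r}\right]^{-1},$$ where the last expression is used when $k<n$.
   Context: Notation: $[a]=\{1,\ldots,a\}$; all entropies $H$ are in $q$-ary units (logarithm base $q$). MDS-PIR capacity-achieving code: for an $[n,k]$ linear code $\mathscr{C}$ with generator matrix $G$, an information set is a set $\mathcal{I}\subseteq[n]$ of size $k$ such that the columns of $G$ indexed by $\mathcal{I}$ form an invertible matrix. A PIR achievable rate matrix for $\mathscr{C}$ is a $\nu\times n$ binary matrix $\Lambda_{\kappa,\nu}$ such that every column has Hamming weight $\kappa$ and the support of every row contains an information set of $\mathscr{C}$. The code is MDS-PIR capacity-achieving if such a matrix exists with $\kappa/\nu=k/n$. Storage: there are $f$ independent messages $\mathbf{W}^{(1)},\ldots,\mathbf{W}^{(f)}$; each $\mathbf{W}^{(m)}$ is a random $\beta\times k$ matrix with entries i.i.d. uniform over $\mathbb{F}_q$, also written as a vector $(W^{(m)}_1,\ldots,W^{(m)}_{\mathsf{L}})$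 with $\mathsf{L}=\beta k$. Each row $\mathbf{W}^{(m)}_i$ is encoded as $(C^{(m)}_{i,1},\ldots,C^{(m)}_{i,n})=\mathbf{W}^{(m)}_iG$. Database $j\in[n]$ stores $\mathbf{C}_j=(C^{(m)}_{i,j})_{i\in[\beta],m\in[f]}$. Candidate linear functions: for $l\in[\mathsf{L}]$, $(X^{(1)}_l,\ldots,X^{(\mu)}_l)^{\mathsf T}=V\,(W^{(1)}_l,\ldots,W^{(f)}_l)^{\mathsf T}$, and $\mathbf{X}^{(v)}=(X^{(v)}_1,\ldots,X^{(v)}_{\mathsf{L}})$, $\mathbf{X}^{[\mu]}=(\mathbf{X}^{(1)},\ldots,\mathbf{X}^{(\mu)})$. Since the rows of $V$ are nonzero, each $X^{(v)}_l$ is uniform on $\mathbb{F}_q$, so $\mathsf{H}_{\min}=\min_vH(X^{(v)}_l)=1$. PLC protocol: for each desired index $v\in[\mu]$ the user sends a (random) query $Q^{(v)}_j$ to each database $j\in[n]$. The queries are independent of the messages, so in particular $I(\mathbf{X}^{(1)},\ldots,\mathbf{X}^{(\mu)};Q^{(v)}_1,\ldots,Q^{(v)}_n)=0$. Database $j$ returns an answer $A^{(v)}_j$ that is a deterministic function of $Q^{(v)}_j$ and $\mathbf{C}_j$. The protocol must satisfy, for all $v\ne v'$ in $[\mu]$ and $j\in[n]$: (privacy) $(Q^{(v)}_j,A^{(v)}_j,\mathbf{X}^{[\mu]})$ and $(Q^{(v')}_j,A^{(v')}_j,\mathbf{X}^{[\mu]})$ are identically distributed; (recovery) $H(\mathbf{X}^{(v)}\mid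 A^{(v)}_1,\ldots,A^{(v)}_n,Q^{(v)}_1,\ldots,Q^{(v)}_n)=0$. Rate: the rate of a protocol is $\mathsf{R}=\mathsf{L}\mathsf{H}_{\min}/\mathsf{D}$, where $\mathsf{D}=\sum_{j=1}^nH(A^{(v)}_j)$ is the total download cost (independent of $v$ by privacy). The capacity is the maximum (supremum) of rates over all protocols (with arbitrary $\beta$) for the given storage code and $V$. *)

theory Defs
  imports "HOL-Probability.Probability" "Jordan_Normal_Form.DL_Rank"
    "Jordan_Normal_Form.DL_Submatrix"
begin

text \<open>
  All indices start at 0: databases are \<open>j < n\<close>, messages \<open>m < f\<close>, candidate functions \<open>v < \<mu>\<close>.
  A code is given by its generator matrix \<open>G\<close>, so that \<open>k = dim_row G\<close> and \<open>n = dim_col G\<close>;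
  the candidate functions are the rows of \<open>V\<close>, so that \<open>\<mu> = dim_row V\<close> and \<open>f = dim_col V\<close>.
\<close>


subsection \<open>MDS-PIR capacity-achieving codes\<close>

definition generator_matrix :: "nat \<Rightarrow> nat \<Rightarrow> 'q::field mat \<Rightarrow> bool" where
  "generator_matrix n k G \<longleftrightarrow> 1 \<le> k \<and> G \<in> carrier_mat k n \<and> vec_space.rank k G = k"

definition information_set :: "'q::field mat \<Rightarrow> nat set \<Rightarrow> bool" where
  "information_set G I \<longleftrightarrow>
     I \<subseteq> {..<dim_col G} \<and> card I = dim_row G \<and> invertible_mat (submatrix G UNIV I)"

definition PIR_achievable_rate_matrix ::
    "'q::field mat \<Rightarrow> nat \<Rightarrow> nat \<Rightarrow> nat mat \<Rightarrow> bool" where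
  "PIR_achievable_rate_matrix G \<kappa> \<nu> \<Lambda> \<longleftrightarrow>
     \<Lambda> \<in> carrier_mat \<nu> (dim_col G) \<and> elements_mat \<Lambda> \<subseteq> {0, 1} \<and>
     (\<forall>j<dim_col G. card {i. i < \<nu> \<and> \<Lambda> $$ (i, j) \<noteq> 0} = \<kappa>) \<and>
     (\<forall>i<\<nu>. \<exists>I. information_set G I \<and> I \<subseteq> {j. j < dim_col G \<and> \<Lambda> $$ (i, j) \<noteq> 0})"

definition MDS_PIR_capacity_achieving :: "'q::field mat \<Rightarrow> bool" where
  "MDS_PIR_capacity_achieving G \<longleftrightarrow>
     (\<exists>\<kappa> \<nu> \<Lambda>. 0 < \<nu> \<and> PIR_achievable_rate_matrix G \<kappa> \<nu> \<Lambda> \<and>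
        real \<kappa> / real \<nu> = real (dim_row G) / real (dim_col G))"


subsection \<open>Entropy of discrete random variables\<close>

text \<open>
  The library's \<open>entropy\<close> is a Bochner integral and hence 0 when \<open>- log b p(X)\<close> is not integrable,
  whereas the entropy is then infinite.
\<close>
definition shannon_entropy :: "real \<Rightarrow> 'a::countable pmf \<Rightarrow> ennreal" where
  "shannon_entropy b p =
     (if integrable (measure_pmf p) (\<lambda>x. log b (pmf p x))
      then ennreal (prob_space.entropy (measure_pmf p) b (count_space UNIV) (\<lambda>x. x))
      else \<infinity>)"

text \<open>
  Only used for \<open>X\<close> with finitely many values; the integral in the library definition then exists.
\<close>
definition shannon_cond_entropy ::
    "real \<Rightarrow> 'w pmf \<Rightarrow> ('w \<Rightarrow> 'a::countable) \<Rightarrow> ('w \<Rightarrow> 'b::countable) \<Rightarrow> real" where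
  "shannon_cond_entropy b M X Y =
     prob_space.conditional_entropy (measure_pmf M) b (count_space UNIV) (count_space UNIV) X Y"

lemma information_space_pmf: "1 < b \<Longrightarrow> information_space (measure_pmf p) b"
  by (simp add: information_space_def information_space_axioms_def prob_space_measure_pmf)

lemma distributed_pmf:
  "distributed (measure_pmf M) (count_space UNIV) X (\<lambda>x. ennreal (pmf (map_pmf X M) x))"
proof -
  have "distr (measure_pmf M) (count_space UNIV) X = measure_pmf (map_pmf X M)"
    by (simp add: map_pmf_rep_eq)
  then show ?thesis
    by (simp add: distributed_def measure_pmf_eq_density[symmetric])
qed

lemma shannon_entropy_eq_nn_integral:
  fixes p :: "'a::countable pmf"
  assumes b: "1 < b"
  shows "shannon_entropy b p = (\<integral>\<^sup>+x. ennreal (- log b (pmf p x)) \<partial>measure_pmf p)"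
proof -
  interpret information_space "measure_pmf p" b
    using b by (rule information_space_pmf)
  have nonneg: "AE x in measure_pmf p. 0 \<le> - log b (pmf p x)"
    by (rule AE_pmfI) (use b in \<open>auto simp: set_pmf_iff pmf_le_1 pmf_pos\<close>)
  show ?thesis
  proof (cases "integrable (measure_pmf p) (\<lambda>x. log b (pmf p x))")
    case True
    have "prob_space.entropy (measure_pmf p) b (count_space UNIV) (\<lambda>x::'a. x)
        = - (\<integral>x. pmf p x * log b (pmf p x) \<partial>count_space UNIV)"
      using entropy_distr[OF distributed_pmf[of p "\<lambda>x. x"]] by simp
    also have "(\<integral>x. pmf p x * log b (pmf p x) \<partial>count_space UNIV) = (\<integral>x. log b (pmf p x) \<partial>measure_pmf p)"
      by (subst measure_pmf_eq_density) (simp add: integral_density)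
    finally have "prob_space.entropy (measure_pmf p) b (count_space UNIV) (\<lambda>x::'a. x) = (\<integral>x. - log b (pmf p x) \<partial>measure_pmf p)"
      by simp
    then show ?thesis
      using True nonneg
      by (simp add: shannon_entropy_def nn_integral_eq_integral del: integral_minus)
  next
    case False
    then have "\<not> integrable (measure_pmf p) (\<lambda>x. - log b (pmf p x))"
      by simp
    then have "(\<integral>\<^sup>+x. ennreal (- log b (pmf p x)) \<partial>measure_pmf p) = \<infinity>"
      using nonneg integrableI_nonneg[of "\<lambda>x. - log b (pmf p x)" "measure_pmf p"]
      by (auto simp: less_top[symmetric])
    then show ?thesis
      using False by (simp add: shannon_entropy_def)
  qed
qed

lemma shannon_cond_entropy_eq_integral:
  fixes X :: "'w \<Rightarrow> 'a::countable" and Y :: "'w \<Rightarrow> 'b::countable"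
  assumes b: "1 < b"
  shows "shannon_cond_entropy b M X Y =
    (\<integral>\<omega>. - log b (pmf (map_pmf (\<lambda>\<omega>. (X \<omega>, Y \<omega>)) M) (X \<omega>, Y \<omega>) / pmf (map_pmf Y M) (Y \<omega>))
       \<partial>measure_pmf M)"
proof -
  interpret information_space "measure_pmf M" b
    using b by (rule information_space_pmf)
  let ?J = "map_pmf (\<lambda>\<omega>. (X \<omega>, Y \<omega>)) M"
  let ?g = "\<lambda>z. log b (pmf ?J z / pmf (map_pmf Y M) (snd z))"
  have pair_count: "count_space UNIV \<Otimes>\<^sub>M count_space UNIV = (count_space UNIV :: ('a \<times> 'b) measure)"
    by (simp add: pair_measure_countable)
  have joint: "distributed (measure_pmf M) (count_space UNIV \<Otimes>\<^sub>M count_space UNIV)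
      (\<lambda>\<omega>. (X \<omega>, Y \<omega>)) (\<lambda>z. ennreal (pmf ?J z))"
    unfolding pair_count by (rule distributed_pmf)
  have "prob_space.conditional_entropy (measure_pmf M) b (count_space UNIV) (count_space UNIV) X Y =
      - (\<integral>(x, y). pmf ?J (x, y) * log b (pmf ?J (x, y) / pmf (map_pmf Y M) y)
          \<partial>(count_space UNIV \<Otimes>\<^sub>M count_space UNIV))"
    by (rule conditional_entropy_generic_eq[OF sigma_finite_measure_count_space
          sigma_finite_measure_count_space distributed_pmf _ joint])
      (rule pmf_nonneg)+
  then have "shannon_cond_entropy b M X Y = - (\<integral>z. pmf ?J z * ?g z \<partial>count_space UNIV)"
    unfolding shannon_cond_entropy_def pair_count by (simp only: split_beta' prod.collapse)
  also have "(\<integral>z. pmf ?J z * ?g z \<partial>count_space UNIV) = (\<integral>z. ?g z \<partial>measure_pmf ?J)"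
    by (subst measure_pmf_eq_density) (simp add: integral_density)
  finally show ?thesis
    by simp
qed


subsection \<open>Storage and candidate functions\<close>

text \<open>
  \<open>w (m, i, c)\<close> is the entry in row \<open>i\<close> and column \<open>c\<close> of the \<open>\<beta> \<times> k\<close> matrix of message \<open>m\<close>;
  message vectors of length \<open>\<beta> * k\<close> list the entries row by row.
\<close>
type_synonym 'q messages = "nat \<times> nat \<times> nat \<Rightarrow> 'q"

definition messages_pmf :: "nat \<Rightarrow> nat \<Rightarrow> nat \<Rightarrow> 'q::{field,finite} messages pmf" where
  "messages_pmf f \<beta> k = Pi_pmf ({..<f} \<times> {..<\<beta>} \<times> {..<k}) 0 (\<lambda>_. pmf_of_set UNIV)"

definition message_matrix :: "nat \<Rightarrow> nat \<Rightarrow> 'q messages \<Rightarrow> nat \<Rightarrow> 'q mat" where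
  "message_matrix \<beta> k w m = Matrix.mat \<beta> k (\<lambda>(i, c). w (m, i, c))"

definition message_symbol :: "nat \<Rightarrow> 'q messages \<Rightarrow> nat \<Rightarrow> nat \<Rightarrow> 'q" where
  "message_symbol k w m l = w (m, l div k, l mod k)"

definition stored_content ::
    "'q::{field,finite} mat \<Rightarrow> nat \<Rightarrow> nat \<Rightarrow> 'q messages \<Rightarrow> nat \<Rightarrow> 'q Matrix.vec list" where
  "stored_content G f \<beta> w j = map (\<lambda>m. col (message_matrix \<beta> (dim_row G) w m * G) j) [0..<f]"

definition candidate_symbol ::
    "'q::{field,finite} mat \<Rightarrow> nat \<Rightarrow> 'q messages \<Rightarrow> nat \<Rightarrow> nat \<Rightarrow> 'q" where
  "candidate_symbol V k w v l =
     vec_index (V *\<^sub>v Matrix.vec (dim_col V) (\<lambda>m. message_symbol k w m l)) v"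

definition candidate ::
    "'q::{field,finite} mat \<Rightarrow> nat \<Rightarrow> nat \<Rightarrow> 'q messages \<Rightarrow> nat \<Rightarrow> 'q list" where
  "candidate V \<beta> k w v = map (candidate_symbol V k w v) [0..<\<beta> * k]"

definition candidates ::
    "'q::{field,finite} mat \<Rightarrow> nat \<Rightarrow> nat \<Rightarrow> 'q messages \<Rightarrow> 'q list list" where
  "candidates V \<beta> k w = map (candidate V \<beta> k w) [0..<dim_row V]"


subsection \<open>Protocols\<close>

text \<open>
  Queries and answers are arbitrary discrete random variables; as these take at most countably many
  values, natural numbers serve as alphabet. \<open>queries P v\<close> is the joint distribution of the list of
  queries to the \<open>n\<close> databases when function \<open>v\<close> is desired, and \<open>answer P v j q c\<close> is the answer of
  database \<open>j\<close> with content \<open>c\<close> to query \<open>q\<close>. For each \<open>v\<close> the answer is a function of query and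
  content; that the database cannot tell \<open>v\<close> is the privacy condition.
\<close>
record 'q plc_protocol =
  num_rows :: nat
  queries :: "nat \<Rightarrow> nat list pmf"
  answer :: "nat \<Rightarrow> nat \<Rightarrow> nat \<Rightarrow> 'q Matrix.vec list \<Rightarrow> nat"

text \<open>The product distribution makes the queries independent of the messages.\<close>
definition plc_pmf ::
    "'q::{field,finite} mat \<Rightarrow> 'q mat \<Rightarrow> 'q plc_protocol \<Rightarrow> nat \<Rightarrow> ('q messages \<times> nat list) pmf" where
  "plc_pmf G V P v =
     pair_pmf (messages_pmf (dim_col V) (num_rows P) (dim_row G)) (queries P v)"

definition query_rv :: "nat \<Rightarrow> 'q messages \<times> nat list \<Rightarrow> nat" where
  "query_rv j = (\<lambda>(w, qs). qs ! j)"

definition answer_rv ::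
    "'q::{field,finite} mat \<Rightarrow> 'q mat \<Rightarrow> 'q plc_protocol \<Rightarrow> nat \<Rightarrow> nat \<Rightarrow> 'q messages \<times> nat list \<Rightarrow> nat"
  where
  "answer_rv G V P v j =
     (\<lambda>(w, qs). answer P v j (qs ! j) (stored_content G (dim_col V) (num_rows P) w j))"

definition plc_private :: "'q::{field,finite} mat \<Rightarrow> 'q mat \<Rightarrow> 'q plc_protocol \<Rightarrow> bool" where
  "plc_private G V P \<longleftrightarrow>
     (\<forall>v<dim_row V. \<forall>v'<dim_row V. v \<noteq> v' \<longrightarrow> (\<forall>j<dim_col G.
        map_pmf (\<lambda>\<omega>. (query_rv j \<omega>, answer_rv G V P v j \<omega>,
            candidates V (num_rows P) (dim_row G) (fst \<omega>))) (plc_pmf G V P v) =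
        map_pmf (\<lambda>\<omega>. (query_rv j \<omega>, answer_rv G V P v' j \<omega>,
            candidates V (num_rows P) (dim_row G) (fst \<omega>))) (plc_pmf G V P v')))"

definition plc_recoverable :: "'q::{field,finite} mat \<Rightarrow> 'q mat \<Rightarrow> 'q plc_protocol \<Rightarrow> bool" where
  "plc_recoverable G V P \<longleftrightarrow>
     (\<forall>v<dim_row V.
        shannon_cond_entropy (real CARD('q)) (plc_pmf G V P v)
          (\<lambda>\<omega>. candidate V (num_rows P) (dim_row G) (fst \<omega>) v)
          (\<lambda>\<omega>. (map (\<lambda>j. answer_rv G V P v j \<omega>) [0..<dim_col G],
                 map (\<lambda>j. query_rv j \<omega>) [0..<dim_col G])) = 0)"

definition is_plc_protocol :: "'q::{field,finite} mat \<Rightarrow> 'q mat \<Rightarrow> 'q plc_protocol \<Rightarrow> bool" where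
  "is_plc_protocol G V P \<longleftrightarrow>
     1 \<le> num_rows P \<and>
     (\<forall>v<dim_row V. \<forall>qs\<in>set_pmf (queries P v). length qs = dim_col G) \<and>
     plc_private G V P \<and> plc_recoverable G V P"


subsection \<open>Rate and capacity\<close>

text \<open>The symbols of a candidate function are identically distributed, so symbol 0 represents all.\<close>
definition H_min :: "'q::{field,finite} mat \<Rightarrow> 'q mat \<Rightarrow> 'q plc_protocol \<Rightarrow> ennreal" where
  "H_min G V P =
     Min ((\<lambda>v. shannon_entropy (real CARD('q))
            (map_pmf (\<lambda>w. candidate_symbol V (dim_row G) w v 0)
              (messages_pmf (dim_col V) (num_rows P) (dim_row G)))) ` {..<dim_row V})"

definition download_cost ::
    "'q::{field,finite} mat \<Rightarrow> 'q mat \<Rightarrow> 'q plc_protocol \<Rightarrow> nat \<Rightarrow> ennreal" where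
  "download_cost G V P v =
     (\<Sum>j<dim_col G. shannon_entropy (real CARD('q)) (map_pmf (answer_rv G V P v j) (plc_pmf G V P v)))"

definition plc_rate :: "'q::{field,finite} mat \<Rightarrow> 'q mat \<Rightarrow> 'q plc_protocol \<Rightarrow> nat \<Rightarrow> ennreal" where
  "plc_rate G V P v = of_nat (num_rows P * dim_row G) * H_min G V P / download_cost G V P v"

lemma download_cost_indep:
  assumes "plc_private G V P" "v < dim_row V" "v' < dim_row V"
  shows "download_cost G V P v = download_cost G V P v'"
proof (cases "v = v'")
  case False
  have "map_pmf (answer_rv G V P v j) (plc_pmf G V P v) =
      map_pmf (answer_rv G V P v' j) (plc_pmf G V P v')" if "j < dim_col G" for j
  proof -
    have "map_pmf (\<lambda>\<omega>. (query_rv j \<omega>, answer_rv G V P v j \<omega>,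
            candidates V (num_rows P) (dim_row G) (fst \<omega>))) (plc_pmf G V P v) =
        map_pmf (\<lambda>\<omega>. (query_rv j \<omega>, answer_rv G V P v' j \<omega>,
            candidates V (num_rows P) (dim_row G) (fst \<omega>))) (plc_pmf G V P v')"
      using assms False that unfolding plc_private_def by blast
    from arg_cong[OF this, of "map_pmf (\<lambda>(_, a, _). a)"] show ?thesis
      by (simp add: map_pmf_comp)
  qed
  then show ?thesis
    by (simp add: download_cost_def)
qed simp

definition plc_capacity :: "'q::{field,finite} mat \<Rightarrow> 'q mat \<Rightarrow> ennreal" where
  "plc_capacity G V = Sup {plc_rate G V P v | P v. is_plc_protocol G V P \<and> v < dim_row V}"

end

theory Submission
  imports Defs
begin

text \<open>
  Write \<open>L = \<beta> * k\<close>, \<open>\<rho> = k / n\<close>, and for a set \<open>S\<close> of candidate functions let \<open>B S\<close> be the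
  sum over all databases of \<open>H(A_j | Q_j, X\<^sup>S)\<close>. By privacy \<open>B S\<close> does not depend on the desired
  function, so we may let it be any \<open>v\<close> whose row is not spanned by the rows in \<open>S\<close>. Recovery of
  \<open>X\<^sup>v\<close>, which is uniform given \<open>X\<^sup>S\<close>, gives
  \<open>B S \<ge> H(A | Q, X\<^sup>S) \<ge> L + H(A | Q, X\<^sup>S, X\<^sup>v)\<close>. Given any candidate functions, the contents of the
  databases of an information set are independent; averaging over the rows of the rate matrix, whose
  supports are exactly information sets, bounds the last term below by \<open>\<rho> * B (S \<union> {v})\<close>. Iterating
  \<open>r\<close> times from \<open>S = {}\<close> gives \<open>D \<ge> B {} \<ge> L * (1 + \<rho> + \<dots> + \<rho> ^ (r - 1))\<close>.

  All conditional entropies are taken for a fixed list of queries, where everything is a function of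
  the uniformly distributed messages, and then integrated over the queries.
\<close>

subsection \<open>Entropy of functions on a finite uniform space\<close>

text \<open>Joint random variables indexed by a set \<open>I\<close> are encoded as restricted
  functions, so that equality of joint values means equality at every index in
  \<open>I\<close>.\<close>

lemma restrict_eqD: "restrict g I = restrict h I \<Longrightarrow> i \<in> I \<Longrightarrow> g i = h i"
  by (drule fun_cong[of _ _ i]) simp

lemma restrict_eq_iff: "restrict g I = restrict h I \<longleftrightarrow> (\<forall>i\<in>I. g i = h i)"
  by (auto intro: restrict_ext dest: restrict_eqD)

locale finite_uniform =
  fixes \<Omega> :: "'w set" and b :: real
  assumes finite_space: "finite \<Omega>" and nonempty: "\<Omega> \<noteq> {}" and base: "1 < b"
begin

text \<open>Indexed by a point rather than by a value: the probability of the value at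
  \<open>w\<close> is then a weight on \<open>w\<close>, and entropies are plain sums over
  \<open>\<Omega>\<close>.\<close>

definition fibre :: "('w \<Rightarrow> 'a) \<Rightarrow> 'w \<Rightarrow> 'w set" where
  "fibre g w = {w' \<in> \<Omega>. g w' = g w}"

text \<open>\<open>H g\<close> and \<open>Hc g h\<close> are the entropies \<open>H(g w)\<close> and \<open>H(g w | h w)\<close> for \<open>w\<close> uniform on \<open>\<Omega>\<close>.\<close>
definition H :: "('w \<Rightarrow> 'a) \<Rightarrow> real" where
  "H g = (\<Sum>w\<in>\<Omega>. log b (real (card \<Omega>) / real (card (fibre g w)))) / real (card \<Omega>)"

definition Hc :: "('w \<Rightarrow> 'a) \<Rightarrow> ('w \<Rightarrow> 'c) \<Rightarrow> real" where
  "Hc g h = H (\<lambda>w. (g w, h w)) - H h"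

lemma card_space_pos: "0 < card \<Omega>"
  using finite_space nonempty by (simp add: card_gt_0_iff)

lemma finite_fibre [simp]: "finite (fibre g w)"
  using finite_space by (simp add: fibre_def)

lemma card_fibre_pos: "w \<in> \<Omega> \<Longrightarrow> 0 < card (fibre g w)"
  by (subst card_gt_0_iff) (auto simp: fibre_def finite_space)

lemma fibre_nonempty [simp]: "w \<in> \<Omega> \<Longrightarrow> fibre g w \<noteq> {}"
  by (auto simp: fibre_def)

text \<open>A value is attained at exactly as many points as its fibre has elements, so these
  weights count each value once.\<close>

lemma sum_over_fibres:
  fixes F :: "'a \<Rightarrow> real"
  shows "(\<Sum>w\<in>\<Omega>. F (g w) / real (card (fibre g w))) = (\<Sum>x\<in>g ` \<Omega>. F x)"
proof -
  have "(\<Sum>w\<in>\<Omega>. F (g w) / real (card (fibre g w))) =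
      (\<Sum>x\<in>g ` \<Omega>. \<Sum>w\<in>{w \<in> \<Omega>. g w = x}. F (g w) / real (card (fibre g w)))"
    by (rule sum.image_gen[OF finite_space])
  also have "\<dots> = (\<Sum>x\<in>g ` \<Omega>. F x)"
  proof (rule sum.cong[OF refl])
    fix x assume "x \<in> g ` \<Omega>"
    then obtain w0 where w0: "w0 \<in> \<Omega>" "x = g w0" by blast
    have "(\<Sum>w\<in>{w \<in> \<Omega>. g w = x}. F (g w) / real (card (fibre g w))) =
        (\<Sum>w\<in>fibre g w0. F x / real (card (fibre g w0)))"
      by (rule sum.cong) (auto simp: fibre_def w0)
    also have "\<dots> = F x"
      using w0(1) by simp
    finally show "(\<Sum>w\<in>{w \<in> \<Omega>. g w = x}. F (g w) / real (card (fibre g w))) = F x" .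
  qed
  finally show ?thesis .
qed

text \<open>Gibbs' inequality for a subprobability \<open>p\<close>: apply
  \<open>ln x \<le> x - 1\<close> to the ratio of \<open>p\<close> to the true distribution of
  \<open>g\<close> and average over \<open>\<Omega>\<close>.\<close>

lemma gibbs:
  fixes p :: "'a \<Rightarrow> real"
  assumes pos: "\<And>w. w \<in> \<Omega> \<Longrightarrow> 0 < p (g w)" and total: "(\<Sum>x\<in>g ` \<Omega>. p x) \<le> 1"
  shows "H g \<le> (\<Sum>w\<in>\<Omega>. - log b (p (g w))) / real (card \<Omega>)"
proof -
  let ?N = "\<lambda>w. real (card (fibre g w))" and ?c = "real (card \<Omega>)"
  have c: "0 < ?c" using card_space_pos by simp
  have lnb: "0 < ln b" using base by simp
  have "(\<Sum>w\<in>\<Omega>. log b (?c / ?N w) + log b (p (g w))) \<le> (\<Sum>w\<in>\<Omega>. (?c * (p (g w) / ?N w) - 1) / ln b)"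
  proof (rule sum_mono)
    fix w assume w: "w \<in> \<Omega>"
    have N: "0 < ?N w" using card_fibre_pos[OF w] by simp
    have "log b (?c / ?N w) + log b (p (g w)) = ln (?c * (p (g w) / ?N w)) / ln b"
      using w N c pos[OF w] by (simp add: log_def ln_mult ln_div add_divide_distrib diff_divide_distrib)
    also have "\<dots> \<le> (?c * (p (g w) / ?N w) - 1) / ln b"
      using N c pos[OF w] lnb by (intro divide_right_mono ln_le_minus_one) auto
    finally show "log b (?c / ?N w) + log b (p (g w)) \<le> (?c * (p (g w) / ?N w) - 1) / ln b" .
  qed
  also have "\<dots> = (?c * (\<Sum>w\<in>\<Omega>. p (g w) / ?N w) - ?c) / ln b"
    by (simp add: sum_divide_distrib[symmetric] sum_subtractf sum_distrib_left)
  also have "(\<Sum>w\<in>\<Omega>. p (g w) / ?N w) = (\<Sum>x\<in>g ` \<Omega>. p x)"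
    by (rule sum_over_fibres)
  also have "(?c * \<dots> - ?c) / ln b \<le> 0"
    using total c lnb by (simp add: divide_le_0_iff mult_left_le)
  finally show ?thesis
    using c by (simp add: H_def sum.distrib sum_negf field_simps)
qed

section \<open>Monotonicity and counting bounds for entropy\<close>

lemma H_mono:
  assumes "\<And>w w'. w \<in> \<Omega> \<Longrightarrow> w' \<in> \<Omega> \<Longrightarrow> g w = g w' \<Longrightarrow> h w = h w'"
  shows "H h \<le> H g"
  unfolding H_def
proof (intro divide_right_mono sum_mono)
  fix w assume w: "w \<in> \<Omega>"
  have "fibre g w \<subseteq> fibre h w"
    using assms[OF _ w] by (auto simp: fibre_def)
  then have "card (fibre g w) \<le> card (fibre h w)"
    by (rule card_mono[OF finite_fibre])
  then show "log b (real (card \<Omega>) / real (card (fibre h w))) \<le> log b (real (card \<Omega>) / real (card (fibre g w)))"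
    using base card_fibre_pos[OF w, of g] card_fibre_pos[OF w, of h] card_space_pos
    by (subst log_le_cancel_iff) (auto intro!: divide_left_mono)
qed simp

lemma H_eqI:
  assumes "\<And>w w'. w \<in> \<Omega> \<Longrightarrow> w' \<in> \<Omega> \<Longrightarrow> g w = g w' \<longleftrightarrow> h w = h w'"
  shows "H g = H h"
  by (intro antisym H_mono) (auto simp: assms)

lemma H_le_log_card:
  assumes "g ` \<Omega> \<subseteq> T" "finite T"
  shows "H g \<le> log b (real (card T))"
proof -
  have T: "0 < card T" using assms nonempty by (auto simp: card_gt_0_iff)
  have "H g \<le> (\<Sum>w\<in>\<Omega>. - log b ((\<lambda>_. 1 / real (card T)) (g w))) / real (card \<Omega>)"
  proof (rule gibbs)
    show "(\<Sum>x\<in>g ` \<Omega>. 1 / real (card T)) \<le> 1"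
      using T card_mono[OF assms(2,1)] by (simp add: field_simps)
  qed (use T in simp)
  also have "\<dots> = log b (real (card T))"
    using T card_space_pos by (simp add: log_divide)
  finally show ?thesis .
qed

text \<open>The comparison of fibre sizes is averaged pointwise. It lets an entropy gain be proved
  by an injection between fibres, without computing a conditional distribution.\<close>

lemma H_fibre_ratio:
  assumes M: "0 < M" and le: "\<And>w. w \<in> \<Omega> \<Longrightarrow> M * card (fibre g w) \<le> card (fibre h w)"
  shows "H h + log b (real M) \<le> H g"
proof -
  have "(\<Sum>w\<in>\<Omega>. log b (real (card \<Omega>) / real (card (fibre h w))) + log b (real M))
      \<le> (\<Sum>w\<in>\<Omega>. log b (real (card \<Omega>) / real (card (fibre g w))))"
  proof (rule sum_mono)
    fix w assume w: "w \<in> \<Omega>"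
    have "log b (real M * real (card (fibre g w))) \<le> log b (real (card (fibre h w)))"
      using base M le[OF w] w by (simp add: card_gt_0_iff flip: of_nat_mult)
    then show "log b (real (card \<Omega>) / real (card (fibre h w))) + log b (real M)
        \<le> log b (real (card \<Omega>) / real (card (fibre g w)))"
      using M w card_space_pos by (simp add: log_divide log_mult)
  qed
  then have "((\<Sum>w\<in>\<Omega>. log b (real (card \<Omega>) / real (card (fibre h w)))) + real (card \<Omega>) * log b (real M)) / real (card \<Omega>)
      \<le> (\<Sum>w\<in>\<Omega>. log b (real (card \<Omega>) / real (card (fibre g w)))) / real (card \<Omega>)"
    by (intro divide_right_mono) (simp_all add: sum.distrib)
  then show ?thesis
    using card_space_pos by (simp add: H_def add_divide_distrib)
qed

lemma H_inj:
  assumes "inj_on g \<Omega>"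
  shows "H g = log b (real (card \<Omega>))"
proof -
  have "fibre g w = {w}" if "w \<in> \<Omega>" for w
    using assms that by (auto simp: fibre_def inj_on_def)
  then show ?thesis
    using card_space_pos by (simp add: H_def)
qed

lemma card_partition:
  "card {w \<in> \<Omega>. h w = z} = (\<Sum>x\<in>e ` \<Omega>. card {w \<in> \<Omega>. e w = x \<and> h w = z})"
proof -
  have "{w \<in> \<Omega>. h w = z} = (\<Union>x\<in>e ` \<Omega>. {w \<in> \<Omega>. e w = x \<and> h w = z})" by auto
  also have "card \<dots> = (\<Sum>x\<in>e ` \<Omega>. card {w \<in> \<Omega>. e w = x \<and> h w = z})"
    using finite_space by (intro card_UN_disjoint) auto
  finally show ?thesis .
qed

text \<open>Gibbs' inequality for the distribution \<open>?p\<close> that keeps the joint laws with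
  \<open>h\<close> but makes \<open>f\<close> and \<open>g\<close> conditionally independent given
  \<open>h\<close>.\<close>

lemma submodular:
  "H (\<lambda>w. (f w, g w, h w)) + H h \<le> H (\<lambda>w. (f w, h w)) + H (\<lambda>w. (g w, h w))"
proof -
  let ?c = "real (card \<Omega>)"
  let ?n = "\<lambda>a c. real (card {w \<in> \<Omega>. f w = a \<and> h w = c})"
  let ?m = "\<lambda>a c. real (card {w \<in> \<Omega>. g w = a \<and> h w = c})"
  let ?l = "\<lambda>c. real (card {w \<in> \<Omega>. h w = c})"
  let ?p = "\<lambda>(x, y, z). ?n x z * ?m y z / (?l z * ?c)"
  have nf: "?n (f w) (h w) = real (card (fibre (\<lambda>w. (f w, h w)) w))"
    and mf: "?m (g w) (h w) = real (card (fibre (\<lambda>w. (g w, h w)) w))"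
    and lf: "?l (h w) = real (card (fibre h w))" for w
    by (simp_all add: fibre_def)
  have c: "0 < ?c" using card_space_pos by simp
  have tot: "(\<Sum>x\<in>(\<lambda>w. (f w, g w, h w)) ` \<Omega>. ?p x) \<le> 1"
  proof -
    have n: "(\<Sum>x\<in>f ` \<Omega>. ?n x z) = ?l z" and m: "(\<Sum>y\<in>g ` \<Omega>. ?m y z) = ?l z" for z
    proof -
      show "(\<Sum>x\<in>f ` \<Omega>. ?n x z) = ?l z" "(\<Sum>y\<in>g ` \<Omega>. ?m y z) = ?l z"
        by (simp_all only: of_nat_sum[symmetric] card_partition[symmetric])
    qed
    \<comment> \<open>Enlarging the attained triples to the full product makes the sum factor for
      each fixed value \<open>z\<close> of \<open>h\<close>.\<close>
    have "(\<Sum>x\<in>(\<lambda>w. (f w, g w, h w)) ` \<Omega>. ?p x) \<le> (\<Sum>x\<in>f ` \<Omega> \<times> g ` \<Omega> \<times> h ` \<Omega>. ?p x)"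
      using finite_space by (intro sum_mono2) auto
    also have "\<dots> = (\<Sum>x\<in>f ` \<Omega>. \<Sum>y\<in>g ` \<Omega>. \<Sum>z\<in>h ` \<Omega>. ?n x z * ?m y z / (?l z * ?c))"
      by (simp only: sum.cartesian_product split_def fst_conv snd_conv)
    also have "\<dots> = (\<Sum>x\<in>f ` \<Omega>. \<Sum>z\<in>h ` \<Omega>. \<Sum>y\<in>g ` \<Omega>. ?n x z * ?m y z / (?l z * ?c))"
      by (rule sum.cong[OF refl]) (rule sum.swap)
    also have "\<dots> = (\<Sum>z\<in>h ` \<Omega>. \<Sum>x\<in>f ` \<Omega>. \<Sum>y\<in>g ` \<Omega>. ?n x z * ?m y z / (?l z * ?c))"
      by (rule sum.swap)
    also have "\<dots> = (\<Sum>z\<in>h ` \<Omega>. (\<Sum>x\<in>f ` \<Omega>. ?n x z) * (\<Sum>y\<in>g ` \<Omega>. ?m y z) / (?l z * ?c))"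
      by (simp only: sum_product sum_divide_distrib)
    also have "\<dots> = (\<Sum>z\<in>h ` \<Omega>. ?l z / ?c)"
      unfolding n m using c by (intro sum.cong) (auto simp: field_simps)
    also have "\<dots> = (\<Sum>w\<in>\<Omega>. ?l (h w) / ?c / real (card (fibre h w)))"
      by (rule sum_over_fibres[symmetric])
    also have "\<dots> = (\<Sum>w\<in>\<Omega>. 1 / ?c)"
      unfolding lf by (intro sum.cong) auto
    also have "\<dots> = 1" using c by simp
    finally show ?thesis .
  qed
  have pos: "0 < ?p ((\<lambda>w. (f w, g w, h w)) w)" if "w \<in> \<Omega>" for w
    using c that unfolding prod.case nf mf lf
    by (intro divide_pos_pos mult_pos_pos) (simp_all add: card_gt_0_iff)
  have "H (\<lambda>w. (f w, g w, h w)) \<le> (\<Sum>w\<in>\<Omega>. - log b (?p (f w, g w, h w))) / ?c"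
    by (rule gibbs[OF pos tot])
  also have "(\<Sum>w\<in>\<Omega>. - log b (?p (f w, g w, h w))) =
      (\<Sum>w\<in>\<Omega>. log b (?c / real (card (fibre (\<lambda>w. (f w, h w)) w)))
        + log b (?c / real (card (fibre (\<lambda>w. (g w, h w)) w)))
        - log b (?c / real (card (fibre h w))))"
  proof (rule sum.cong[OF refl])
    fix w assume w: "w \<in> \<Omega>"
    note P = card_fibre_pos[OF w, of "\<lambda>w. (f w, h w)"] card_fibre_pos[OF w, of "\<lambda>w. (g w, h w)"]
      card_fibre_pos[OF w, of h]
    show "- log b (?p (f w, g w, h w)) = log b (?c / real (card (fibre (\<lambda>w. (f w, h w)) w)))
        + log b (?c / real (card (fibre (\<lambda>w. (g w, h w)) w)))
        - log b (?c / real (card (fibre h w)))"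
      using w P c by (simp only: prod.case nf mf lf) (simp add: log_divide log_mult)
  qed
  finally show ?thesis
    by (simp add: H_def sum.distrib sum_subtractf add_divide_distrib diff_divide_distrib)
qed

section \<open>Conditional entropy and families of random variables\<close>

lemma Hc_nonneg: "0 \<le> Hc f g"
  unfolding Hc_def using H_mono[of "\<lambda>w. (f w, g w)" g] by simp

lemma Hc_chain: "Hc (\<lambda>w. (f w, g w)) h = Hc f (\<lambda>w. (g w, h w)) + Hc g h"
  using H_eqI[of "\<lambda>w. ((f w, g w), h w)" "\<lambda>w. (f w, g w, h w)"] by (auto simp: Hc_def)

lemma Hc_mono:
  assumes "\<And>w w'. w \<in> \<Omega> \<Longrightarrow> w' \<in> \<Omega> \<Longrightarrow> h w = h w' \<Longrightarrow> f w = f w' \<Longrightarrow> g w = g w'"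
  shows "Hc g h \<le> Hc f h"
  unfolding Hc_def
  by (intro diff_right_mono H_mono, simp only: prod.inject, blast intro: assms)

text \<open>Conditioning on more cannot increase entropy: this is submodularity, where the pair of
  \<open>g\<close> and \<open>h\<close> collapses to \<open>g\<close> because \<open>g\<close>
  determines \<open>h\<close>.\<close>

lemma Hc_antimono:
  assumes "\<And>w w'. w \<in> \<Omega> \<Longrightarrow> w' \<in> \<Omega> \<Longrightarrow> g w = g w' \<Longrightarrow> h w = h w'"
  shows "Hc f g \<le> Hc f h"
proof -
  have "H (\<lambda>w. (g w, h w)) = H g" "H (\<lambda>w. (f w, g w, h w)) = H (\<lambda>w. (f w, g w))"
    by (rule H_eqI, simp only: prod.inject, blast intro: assms)+
  then show ?thesis
    using submodular[of f g h] by (simp add: Hc_def)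
qed

text \<open>The chain rule splits off one member, and the conditioning of the others on it is then
  dropped.\<close>

lemma Hc_family_le:
  assumes "finite I"
  shows "Hc (\<lambda>w. \<lambda>i\<in>I. A i w) h \<le> (\<Sum>i\<in>I. Hc (A i) h)"
  using assms
proof induction
  case empty
  have "H (\<lambda>w. (\<lambda>i\<in>{}. A i w, h w)) = H h" by (rule H_eqI) (simp add: restrict_def)
  then show ?case unfolding Hc_def by (simp only: sum.empty diff_self order.refl)
next
  case (insert i I)
  have "Hc (\<lambda>w. \<lambda>i\<in>insert i I. A i w) h \<le> Hc (\<lambda>w. (\<lambda>i\<in>I. A i w, A i w)) h"
  proof (rule Hc_mono)
    fix w w'
    assume eq: "(\<lambda>i\<in>I. A i w, A i w) = (\<lambda>i\<in>I. A i w', A i w')"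
    have "A j w = A j w'" if "j \<in> I" for j
      using eq restrict_eqD[OF _ that, of "\<lambda>i. A i w" "\<lambda>i. A i w'"] by simp
    then show "(\<lambda>i\<in>insert i I. A i w) = (\<lambda>i\<in>insert i I. A i w')"
      using eq by (intro restrict_ext) auto
  qed
  also have "\<dots> = Hc (\<lambda>w. \<lambda>i\<in>I. A i w) (\<lambda>w. (A i w, h w)) + Hc (A i) h"
    by (rule Hc_chain)
  also have "\<dots> \<le> Hc (\<lambda>w. \<lambda>i\<in>I. A i w) h + Hc (A i) h"
    by (intro add_right_mono Hc_antimono) simp
  finally show ?case
    unfolding sum.insert[OF insert.hyps] using insert.IH by linarith
qed

text \<open>Lets unconditional statements be obtained from conditional ones.\<close>

lemma Hc_const: "Hc g (\<lambda>_. c) = H g"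
proof -
  have "H (\<lambda>_. c) = 0" using card_space_pos by (simp add: H_def fibre_def)
  then show ?thesis
    unfolding Hc_def using H_eqI[of "\<lambda>w. (g w, c)" g] by simp
qed

lemma H_family_le:
  assumes "finite I"
  shows "H (\<lambda>w. \<lambda>i\<in>I. A i w) \<le> (\<Sum>i\<in>I. H (A i))"
  using Hc_family_le[OF assms, of A "\<lambda>_. ()"] by (simp only: Hc_const)

text \<open>
  The assumptions make the \<open>C i\<close> independent, also conditionally on \<open>X\<close>, since \<open>X\<close> amounts to
  the family of the \<open>\<psi> i\<close>; phrased this way the claim is a consequence of Shannon inequalities only.
\<close>
lemma Hc_family_ge:
  assumes I: "finite I"
    and C_inj: "inj_on (\<lambda>w. \<lambda>i\<in>I. C i w) \<Omega>"
    and C_card: "(\<Sum>i\<in>I. H (C i)) \<le> log b (real (card \<Omega>))"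
    and \<psi>_C: "\<And>i w w'. i \<in> I \<Longrightarrow> w \<in> \<Omega> \<Longrightarrow> w' \<in> \<Omega> \<Longrightarrow> C i w = C i w' \<Longrightarrow> \<psi> i w = \<psi> i w'"
    and \<psi>_X: "\<And>i w w'. i \<in> I \<Longrightarrow> w \<in> \<Omega> \<Longrightarrow> w' \<in> \<Omega> \<Longrightarrow> X w = X w' \<Longrightarrow> \<psi> i w = \<psi> i w'"
    and X_\<psi>: "\<And>w w'. w \<in> \<Omega> \<Longrightarrow> w' \<in> \<Omega> \<Longrightarrow> (\<And>i. i \<in> I \<Longrightarrow> \<psi> i w = \<psi> i w') \<Longrightarrow> X w = X w'"
    and A_C: "\<And>i w w'. i \<in> I \<Longrightarrow> w \<in> \<Omega> \<Longrightarrow> w' \<in> \<Omega> \<Longrightarrow> C i w = C i w' \<Longrightarrow> A i w = A i w'"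
  shows "(\<Sum>i\<in>I. Hc (A i) X) \<le> Hc (\<lambda>w. \<lambda>i\<in>I. A i w) X"
proof -
  let ?C = "\<lambda>w. \<lambda>i\<in>I. C i w" and ?A = "\<lambda>w. \<lambda>i\<in>I. A i w"
  have CD: "C i w = C i w'" if "?C w = ?C w'" "i \<in> I" for w w' i
    using that by (rule restrict_eqD)
  have AD: "A i w = A i w'" if "?A w = ?A w'" "i \<in> I" for w w' i
    using that by (rule restrict_eqD)
  \<comment> \<open>Since \<open>C i\<close> determines \<open>A i\<close>, H(A_i | X) = H(C_i | X)
    - H(C_i | A_i, X). The first term is at most H(C_i | \<psi>_i), which equals H(C_i) -
    H(\<psi>_i).\<close>
  have step: "H (C i) - H (\<psi> i) - Hc (C i) (\<lambda>w. (A i w, X w)) \<ge> Hc (A i) X" if i: "i \<in> I" for i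
  proof -
    have "H (\<lambda>w. (C i w, \<psi> i w)) = H (C i)"
      by (rule H_eqI, simp only: prod.inject, blast intro: \<psi>_C[OF i])
    then have "H (C i) - H (\<psi> i) = Hc (C i) (\<psi> i)"
      by (simp add: Hc_def)
    also have "\<dots> \<ge> Hc (C i) X"
      by (rule Hc_antimono) (rule \<psi>_X[OF i])
    finally have 1: "Hc (C i) X \<le> H (C i) - H (\<psi> i)" .
    have "H (\<lambda>w. (C i w, A i w, X w)) = H (\<lambda>w. (C i w, X w))"
      by (rule H_eqI, simp only: prod.inject, blast intro: A_C[OF i])
    then show ?thesis using 1 by (simp add: Hc_def)
  qed
  have "(\<Sum>i\<in>I. Hc (A i) X) \<le> (\<Sum>i\<in>I. H (C i) - H (\<psi> i) - Hc (C i) (\<lambda>w. (A i w, X w)))"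
    by (intro sum_mono step)
  also have "\<dots> = (\<Sum>i\<in>I. H (C i)) - (\<Sum>i\<in>I. H (\<psi> i)) - (\<Sum>i\<in>I. Hc (C i) (\<lambda>w. (A i w, X w)))"
    by (simp add: sum_subtractf)
  \<comment> \<open>Injectivity gives \<open>?C\<close> the full entropy of the space, which by
    assumption the sum of the \<open>H (C i)\<close> does not exceed; the two subtracted sums are
    bounded below by subadditivity.\<close>
  also have "\<dots> \<le> H ?C - H X - Hc ?C (\<lambda>w. (?A w, X w))"
  proof -
    have "H X \<le> H (\<lambda>w. \<lambda>i\<in>I. \<psi> i w)"
    proof (intro H_mono X_\<psi>)
      fix w w' i
      assume "(\<lambda>i\<in>I. \<psi> i w) = (\<lambda>i\<in>I. \<psi> i w')" "i \<in> I"
      then show "\<psi> i w = \<psi> i w'"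
        by (rule restrict_eqD)
    qed
    also have "\<dots> \<le> (\<Sum>i\<in>I. H (\<psi> i))" by (rule H_family_le[OF I])
    finally have "H X \<le> (\<Sum>i\<in>I. H (\<psi> i))" .
    moreover have "Hc ?C (\<lambda>w. (?A w, X w)) \<le> (\<Sum>i\<in>I. Hc (C i) (\<lambda>w. (?A w, X w)))"
      by (rule Hc_family_le[OF I])
    moreover have "\<dots> \<le> (\<Sum>i\<in>I. Hc (C i) (\<lambda>w. (A i w, X w)))"
      by (intro sum_mono Hc_antimono, simp only: prod.inject, blast intro: AD)
    ultimately show ?thesis using C_card H_inj[OF C_inj] by linarith
  qed
  also have "\<dots> = Hc ?A X"
  proof -
    \<comment> \<open>\<open>?C\<close> is injective and hence determines \<open>?A\<close> and
      \<open>X\<close>.\<close>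
    have "H (\<lambda>w. (?C w, ?A w, X w)) = H ?C"
      by (rule H_eqI, simp only: prod.inject, metis C_inj inj_onD)
    then show ?thesis by (simp add: Hc_def)
  qed
  finally show ?thesis .
qed

end

subsection \<open>Connection with probability mass functions\<close>

lemma nn_integral_pair_pmf_swap:
  "(\<integral>\<^sup>+z. F z \<partial>measure_pmf (pair_pmf p q)) = (\<integral>\<^sup>+y. \<integral>\<^sup>+x. F (x, y) \<partial>measure_pmf p \<partial>measure_pmf q)"
  by (subst pair_commute_pmf) (simp only: nn_integral_map_pmf nn_integral_pair_pmf' prod.case)

context finite_uniform
begin

abbreviation U :: "'w pmf" where
  "U \<equiv> pmf_of_set \<Omega>"

lemma pmf_map_uniform: "pmf (map_pmf g U) (g w) = real (card (fibre g w)) / real (card \<Omega>)"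
proof -
  have "\<Omega> \<inter> g -` {g w} = fibre g w" by (auto simp: fibre_def)
  then show ?thesis
    using nonempty finite_space by (simp add: pmf_map measure_pmf_of_set)
qed

lemma H_eq_sum: "H g = (\<Sum>w\<in>\<Omega>. - log b (pmf (map_pmf g U) (g w))) / real (card \<Omega>)"
  unfolding H_def pmf_map_uniform
  by (intro arg_cong[of _ _ "\<lambda>x. x / _"] sum.cong refl)
    (use card_space_pos card_fibre_pos in \<open>simp add: log_divide\<close>)

text \<open>Entropy is the expectation of a quantity that depends on the law alone. This carries
  equalities of laws, as in the privacy condition, over to \<open>H\<close>.\<close>

lemma H_distr_cong:
  fixes g h :: "'w \<Rightarrow> 'a"
  assumes "map_pmf g U = map_pmf h U"
  shows "H g = H h"
proof -
  have "H e = (\<integral>x. - log b (pmf (map_pmf e U) x) \<partial>measure_pmf (map_pmf e U))" for e :: "'w \<Rightarrow> 'a"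
    using nonempty finite_space by (simp add: H_eq_sum integral_pmf_of_set del: integral_minus)
  then show ?thesis by (simp only: assms)
qed

lemma nn_integral_uniform:
  assumes "\<And>w. w \<in> \<Omega> \<Longrightarrow> 0 \<le> F w"
  shows "(\<integral>\<^sup>+w. ennreal (F w) \<partial>measure_pmf U) = ennreal ((\<Sum>w\<in>\<Omega>. F w) / real (card \<Omega>))"
  using nonempty finite_space assms card_space_pos
  by (simp add: nn_integral_pmf_of_set sum_ennreal divide_ennreal sum_nonneg ennreal_of_nat_eq_real_of_nat)

lemma log_pmf_nonneg: "0 \<le> - log b (pmf p x)" if "x \<in> set_pmf p"
  using that base by (simp add: pmf_le_1 pmf_pos set_pmf_iff)

lemma shannon_entropy_uniform:
  fixes g :: "'w \<Rightarrow> 'a::countable"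
  shows "shannon_entropy b (map_pmf g U) = ennreal (H g)"
proof -
  have "shannon_entropy b (map_pmf g U) = (\<integral>\<^sup>+w. ennreal (- log b (pmf (map_pmf g U) (g w))) \<partial>measure_pmf U)"
    by (simp add: shannon_entropy_eq_nn_integral[OF base])
  also have "\<dots> = ennreal (H g)"
    unfolding H_eq_sum using nonempty finite_space
    by (intro nn_integral_uniform log_pmf_nonneg) simp
  finally show ?thesis .
qed

text \<open>Conditioning on \<open>q\<close> does not increase entropy: for each \<open>q\<close>,
  Gibbs' inequality compares the law of \<open>g q\<close> with the mixture. The nonnegative
  integral also covers infinite values.\<close>

lemma shannon_entropy_mixture:
  fixes g :: "'q \<Rightarrow> 'w \<Rightarrow> 'a::countable"
  shows "(\<integral>\<^sup>+q. ennreal (H (g q)) \<partial>measure_pmf Q)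
    \<le> shannon_entropy b (map_pmf (\<lambda>(w, q). g q w) (pair_pmf U Q))"
proof -
  let ?p = "map_pmf (\<lambda>(w, q). g q w) (pair_pmf U Q)"
  have supp: "g q w \<in> set_pmf ?p" if "w \<in> \<Omega>" "q \<in> set_pmf Q" for w q
    using that nonempty finite_space by force
  have "shannon_entropy b ?p = (\<integral>\<^sup>+z. ennreal (- log b (pmf ?p (case z of (w, q) \<Rightarrow> g q w))) \<partial>measure_pmf (pair_pmf U Q))"
    by (simp only: shannon_entropy_eq_nn_integral[OF base] nn_integral_map_pmf)
  also have "\<dots> = (\<integral>\<^sup>+q. \<integral>\<^sup>+w. ennreal (- log b (pmf ?p (g q w))) \<partial>measure_pmf U \<partial>measure_pmf Q)"
    by (subst nn_integral_pair_pmf_swap) (simp only: prod.case)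
  also have "\<dots> \<ge> (\<integral>\<^sup>+q. ennreal (H (g q)) \<partial>measure_pmf Q)"
  proof (intro nn_integral_mono_AE AE_pmfI)
    fix q assume q: "q \<in> set_pmf Q"
    have "H (g q) \<le> (\<Sum>w\<in>\<Omega>. - log b (pmf ?p (g q w))) / real (card \<Omega>)"
    proof (rule gibbs)
      show "0 < pmf ?p (g q w)" if "w \<in> \<Omega>" for w
        using supp[OF that q] by (rule pmf_positive)
      show "(\<Sum>x\<in>g q ` \<Omega>. pmf ?p x) \<le> 1"
        using finite_space by (simp add: measure_measure_pmf_finite[symmetric])
    qed
    also have "ennreal \<dots> = (\<integral>\<^sup>+w. ennreal (- log b (pmf ?p (g q w))) \<partial>measure_pmf U)"
      by (intro nn_integral_uniform[symmetric] log_pmf_nonneg supp q)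
    finally show "ennreal (H (g q)) \<le> (\<integral>\<^sup>+w. ennreal (- log b (pmf ?p (g q w))) \<partial>measure_pmf U)"
      by (simp add: ennreal_leI)
  qed
  finally show ?thesis .
qed

end

text \<open>Disintegration: a joint law determines its first marginal and, at points of positive
  mass, the conditional laws. Privacy thereby becomes an equality of laws for a given query.\<close>

lemma bind_map_Pair_eqD:
  assumes eq: "bind_pmf p (\<lambda>y. map_pmf (Pair y) (K y)) = bind_pmf p' (\<lambda>y. map_pmf (Pair y) (K' y))"
  shows "p = p'" and "y \<in> set_pmf p \<Longrightarrow> K y = K' y"
proof -
  have marg: "map_pmf fst (bind_pmf r (\<lambda>y. map_pmf (Pair y) (L y))) = r" for r :: "'a pmf" and L :: "'a \<Rightarrow> 'b pmf"
    by (simp add: map_bind_pmf map_pmf_comp bind_return_pmf')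
  show pp: "p = p'"
    using arg_cong[OF eq, of "map_pmf fst"] by (simp only: marg)
  have joint: "pmf (bind_pmf r (\<lambda>y. map_pmf (Pair y) (L y))) (y, z) = pmf r y * pmf (L y) z"
    for r :: "'a pmf" and L :: "'a \<Rightarrow> 'b pmf" and y z
  proof -
    have "pmf (map_pmf (Pair y') (L y')) (y, z) = pmf (L y) z * indicator {y} y'" for y'
    proof (cases "y' = y")
      case True
      then show ?thesis by (simp add: pmf_map_inj' inj_on_def)
    next
      case False
      then show ?thesis by (auto simp: pmf_eq_0_set_pmf)
    qed
    then show ?thesis
      by (simp add: pmf_bind measure_pmf_single)
  qed
  show "K y = K' y" if "y \<in> set_pmf p"
  proof (rule pmf_eqI)
    fix z
    have "pmf p y * pmf (K y) z = pmf p y * pmf (K' y) z"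
      using arg_cong[OF eq, of "\<lambda>r. pmf r (y, z)"] by (simp only: joint pp)
    then show "pmf (K y) z = pmf (K' y) z"
      using that by (simp add: set_pmf_iff)
  qed
qed

text \<open>A crude domination that suffices to make the integrand of a conditional entropy
  integrable.\<close>

lemma minus_log_le_inverse:
  assumes "1 < b" "0 < r"
  shows "- log b r \<le> (1 / ln b) * (1 / r)"
proof -
  have "ln (1 / r) \<le> 1 / r"
    using ln_le_minus_one[of "1 / r"] assms by simp
  then have "ln (1 / r) / ln b \<le> 1 / r / ln b"
    using assms by (intro divide_right_mono) auto
  then show ?thesis
    using assms by (simp add: log_def ln_div mult.commute)
qed

text \<open>A zero integral of the nonnegative \<open>?g\<close> forces conditional probability 1 on
  the support, which leaves no mass for a second value of \<open>X\<close> at the same value of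
  \<open>Y\<close>. Integrability comes first, because the Bochner integral of a nonintegrable
  function is 0 as well.\<close>

lemma shannon_cond_entropy_eq_0D:
  fixes X :: "'w \<Rightarrow> 'a::countable" and Y :: "'w \<Rightarrow> 'b::countable"
  assumes b: "1 < b" and fin: "finite (X ` set_pmf M)"
    and zero: "shannon_cond_entropy b M X Y = 0"
    and \<omega>: "\<omega> \<in> set_pmf M" and \<omega>': "\<omega>' \<in> set_pmf M" and eq: "Y \<omega> = Y \<omega>'"
  shows "X \<omega> = X \<omega>'"
proof -
  let ?J = "map_pmf (\<lambda>\<omega>. (X \<omega>, Y \<omega>)) M" and ?P = "map_pmf Y M"
  let ?r = "\<lambda>z. pmf ?J z / pmf ?P (snd z)"
  let ?g = "\<lambda>\<omega>. - log b (?r (X \<omega>, Y \<omega>))"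
  have P_eq: "?P = map_pmf snd ?J" by (simp add: map_pmf_comp)
  have J_le: "(\<Sum>z\<in>T. pmf ?J z) \<le> pmf ?P y" if "finite T" "snd ` T \<subseteq> {y}" for T y
  proof -
    have "(\<Sum>z\<in>T. pmf ?J z) = measure ?J T"
      by (rule measure_measure_pmf_finite[symmetric, OF that(1)])
    also have "\<dots> \<le> measure ?J (snd -` {y})"
      using that by (intro measure_pmf.finite_measure_mono) auto
    also have "\<dots> = pmf ?P y" by (simp add: P_eq pmf_map[of snd])
    finally show ?thesis .
  qed
  have J_pos: "0 < pmf ?J (X \<omega>, Y \<omega>)" and P_pos: "0 < pmf ?P (Y \<omega>)" if "\<omega> \<in> set_pmf M" for \<omega>
    using that by (auto intro!: pmf_positive)
  have r: "0 < ?r (X \<omega>, Y \<omega>)" "?r (X \<omega>, Y \<omega>) \<le> 1" if "\<omega> \<in> set_pmf M" for \<omega>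
    using J_pos[OF that] P_pos[OF that] J_le[of "{(X \<omega>, Y \<omega>)}" "Y \<omega>"] by auto
  have g_nonneg: "0 \<le> ?g \<omega>" if "\<omega> \<in> set_pmf M" for \<omega>
    using r[OF that] b by simp
  have g_le: "?g \<omega> \<le> (1 / ln b) * (1 / ?r (X \<omega>, Y \<omega>))" if "\<omega> \<in> set_pmf M" for \<omega>
    by (rule minus_log_le_inverse[OF b r(1)[OF that]])
  have "(\<integral>\<^sup>+\<omega>. ennreal (?g \<omega>) \<partial>measure_pmf M)
      \<le> (\<integral>\<^sup>+\<omega>. ennreal (1 / ln b) * ennreal (1 / ?r (X \<omega>, Y \<omega>)) \<partial>measure_pmf M)"
  proof (intro nn_integral_mono_AE AE_pmfI)
    fix \<omega> assume \<omega>: "\<omega> \<in> set_pmf M"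
    show "ennreal (?g \<omega>) \<le> ennreal (1 / ln b) * ennreal (1 / ?r (X \<omega>, Y \<omega>))"
      using ennreal_leI[OF g_le[OF \<omega>]] b r(1)[OF \<omega>]
      by (subst ennreal_mult'[symmetric]) auto
  qed
  also have "\<dots> = ennreal (1 / ln b) * (\<integral>\<^sup>+z. ennreal (1 / ?r z) \<partial>measure_pmf ?J)"
    by (simp add: nn_integral_cmult)
  also have "\<dots> < \<infinity>"
  proof -
    let ?S = "X ` set_pmf M"
    have "(\<integral>\<^sup>+z. ennreal (1 / ?r z) \<partial>measure_pmf ?J) =
        (\<integral>\<^sup>+z. ennreal (pmf ?J z) * ennreal (1 / ?r z) \<partial>count_space UNIV)"
      by (rule nn_integral_measure_pmf)
    \<comment> \<open>Weighting \<open>1 / ?r\<close> by the joint mass leaves the marginal mass of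
      \<open>Y\<close>, so the integral is at most the number of values of \<open>X\<close>.\<close>
    also have "\<dots> \<le> (\<integral>\<^sup>+z. indicator ?S (fst z) * ennreal (pmf ?P (snd z)) \<partial>count_space UNIV)"
    proof (rule nn_integral_mono)
      fix z :: "'a \<times> 'b"
      show "ennreal (pmf ?J z) * ennreal (1 / ?r z) \<le> indicator ?S (fst z) * ennreal (pmf ?P (snd z))"
      proof (cases "z \<in> set_pmf ?J")
        case True
        then show ?thesis
          by (subst ennreal_mult'[symmetric]) (auto simp: set_pmf_iff[of _ ?J])
      next
        case False
        then have "pmf ?J z = 0" by (simp only: set_pmf_iff not_not)
        then show ?thesis by simp
      qed
    qed
    also have "\<dots> = (\<integral>\<^sup>+x. \<integral>\<^sup>+y. indicator ?S x * ennreal (pmf ?P y) \<partial>count_space UNIV \<partial>count_space UNIV)"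
      by (subst nn_integral_fst_count_space[symmetric]) simp
    also have "\<dots> = (\<integral>\<^sup>+x. indicator ?S x \<partial>count_space UNIV)"
      by (simp add: nn_integral_cmult nn_integral_pmf)
    also have "\<dots> = of_nat (card ?S)"
      using fin by simp
    also have "\<dots> < \<infinity>" by (simp add: of_nat_less_top)
    finally show ?thesis by (simp add: ennreal_mult_less_top)
  qed
  finally have "integrable (measure_pmf M) ?g"
    using g_nonneg by (intro integrableI_nonneg) (auto intro: AE_pmfI)
  moreover have "(\<integral>\<omega>. ?g \<omega> \<partial>measure_pmf M) = 0"
    using zero unfolding shannon_cond_entropy_eq_integral[OF b] by simp
  ultimately have "AE \<omega> in measure_pmf M. ?g \<omega> = 0"
    using g_nonneg by (subst (asm) integral_nonneg_eq_0_iff_AE) (auto intro: AE_pmfI)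
  then have "?g \<omega> = 0"
    using \<omega> by (auto simp: AE_measure_pmf_iff)
  then have "?r (X \<omega>, Y \<omega>) = 1"
    using r[OF \<omega>] b by (simp add: log_def)
  then have full: "pmf ?J (X \<omega>, Y \<omega>) = pmf ?P (Y \<omega>)"
    using P_pos[OF \<omega>] by simp
  show ?thesis
  proof (rule ccontr)
    assume "X \<omega> \<noteq> X \<omega>'"
    then have "pmf ?J (X \<omega>, Y \<omega>) + pmf ?J (X \<omega>', Y \<omega>') \<le> pmf ?P (Y \<omega>)"
      using J_le[of "{(X \<omega>, Y \<omega>), (X \<omega>', Y \<omega>')}" "Y \<omega>"] eq by simp
    then show False using full J_pos[OF \<omega>'] by simp
  qed
qed

subsection \<open>Codes and rank\<close>

text \<open>Summing over the row supports counts every column \<open>\<kappa>\<close> times. Each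
  support turns out to be exactly an information set, so the bound \<open>T\<close> applies to it
  whatever the signs of \<open>h\<close>.\<close>

lemma rate_matrix_average:
  assumes \<Lambda>: "PIR_achievable_rate_matrix G \<kappa> \<nu> \<Lambda>" and \<nu>: "0 < \<nu>" and n: "0 < dim_col G"
    and rate: "real \<kappa> / real \<nu> = real (dim_row G) / real (dim_col G)"
    and T: "\<And>I. information_set G I \<Longrightarrow> (\<Sum>j\<in>I. h j) \<le> T"
  shows "real (dim_row G) / real (dim_col G) * (\<Sum>j<dim_col G. h j) \<le> T"
proof -
  let ?n = "dim_col G" and ?k = "dim_row G"
  define R where "R i = {j. j < ?n \<and> \<Lambda> $$ (i, j) \<noteq> 0}" for i
  have "real (\<kappa> * ?n) = real (\<nu> * ?k)"
    using rate \<nu> n by (simp add: field_simps)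
  then have kn: "\<kappa> * ?n = \<nu> * ?k" by (simp only: of_nat_eq_iff)
  have fin: "finite (R i)" for i by (simp add: R_def)
  have columns: "card {i. i < \<nu> \<and> \<Lambda> $$ (i, j) \<noteq> 0} = \<kappa>" if "j < ?n" for j
    using \<Lambda> that by (simp add: PIR_achievable_rate_matrix_def)
  have count: "(\<Sum>i<\<nu>. \<Sum>j\<in>R i. g j) = (\<Sum>j<?n. real \<kappa> * g j)" for g :: "nat \<Rightarrow> real"
  proof -
    have "(\<Sum>i<\<nu>. \<Sum>j\<in>R i. g j) = (\<Sum>i<\<nu>. \<Sum>j<?n. if \<Lambda> $$ (i, j) \<noteq> 0 then g j else 0)"
    proof (rule sum.cong[OF refl])
      fix i
      have "R i = {j \<in> {..<?n}. \<Lambda> $$ (i, j) \<noteq> 0}" by (auto simp: R_def)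
      then show "(\<Sum>j\<in>R i. g j) = (\<Sum>j<?n. if \<Lambda> $$ (i, j) \<noteq> 0 then g j else 0)"
        by (simp only: sum.inter_filter finite_lessThan)
    qed
    also have "\<dots> = (\<Sum>j<?n. \<Sum>i<\<nu>. if \<Lambda> $$ (i, j) \<noteq> 0 then g j else 0)"
      by (rule sum.swap)
    also have "\<dots> = (\<Sum>j<?n. real \<kappa> * g j)"
    proof (intro sum.cong refl)
      fix j assume "j \<in> {..<?n}"
      then have "card ({..<\<nu>} \<inter> {i. \<Lambda> $$ (i, j) \<noteq> 0}) = \<kappa>"
        using columns[of j] by (simp add: Int_def)
      then show "(\<Sum>i<\<nu>. if \<Lambda> $$ (i, j) \<noteq> 0 then g j else 0) = real \<kappa> * g j"
        by (simp add: sum.If_cases)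
    qed
    finally show ?thesis .
  qed
  have ex: "\<exists>I. information_set G I \<and> I \<subseteq> R i" if "i < \<nu>" for i
    using \<Lambda> that by (auto simp: PIR_achievable_rate_matrix_def R_def)
  have ge: "?k \<le> card (R i)" if "i < \<nu>" for i
    using ex[OF that] card_mono[OF fin] by (metis information_set_def)
  have total: "(\<Sum>i<\<nu>. card (R i)) = \<nu> * ?k"
  proof -
    have "real (\<Sum>i<\<nu>. card (R i)) = real (\<nu> * ?k)"
      using count[of "\<lambda>_. 1"] by (simp flip: kn)
    then show ?thesis by (simp only: of_nat_eq_iff)
  qed
  \<comment> \<open>The row weights add up to \<open>\<nu> * ?k\<close> and none is below
    \<open>?k\<close>, so all are equal to it.\<close>
  have tight: "card (R i) = ?k" if i: "i < \<nu>" for i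
  proof (rule ccontr)
    assume "card (R i) \<noteq> ?k"
    then have "?k < card (R i)" using ge[OF i] by simp
    then have "(\<Sum>i<\<nu>. ?k) < (\<Sum>i<\<nu>. card (R i))"
      using ge i by (intro sum_strict_mono_ex1) auto
    then show False using total by simp
  qed
  have "(\<Sum>j\<in>R i. h j) \<le> T" if i: "i < \<nu>" for i
  proof -
    obtain I where I: "information_set G I" "I \<subseteq> R i" using ex[OF i] by blast
    then have "I = R i"
      using tight[OF i] by (intro card_subset_eq fin) (auto simp: information_set_def)
    then show ?thesis using T[OF I(1)] by simp
  qed
  then have "(\<Sum>i<\<nu>. \<Sum>j\<in>R i. h j) \<le> (\<Sum>i<\<nu>. T)"
    by (intro sum_mono) simp
  then have "real \<kappa> / real \<nu> * (\<Sum>j<?n. h j) \<le> T"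
    using \<nu> by (simp add: count sum_distrib_left[symmetric] field_simps)
  then show ?thesis unfolding rate .
qed

text \<open>Only the zero row vector is annihilated by an invertible matrix. By linearity, the code
  symbols on an information set therefore determine the encoded row.\<close>

lemma information_set_zero:
  fixes G :: "'q::field mat"
  assumes G: "G \<in> carrier_mat k n" and I: "information_set G I"
    and zero: "\<And>j. j \<in> I \<Longrightarrow> (\<Sum>c<k. x c * G $$ (c, j)) = 0" and c: "c < k"
  shows "x c = 0"
proof -
  have In: "I \<subseteq> {..<n}" and cI: "card I = k" and inv: "invertible_mat (submatrix G UNIV I)"
    using I G by (auto simp: information_set_def)
  have J: "{j. j < n \<and> j \<in> I} = I" using In by auto
  let ?S = "submatrix G UNIV I"
  have S: "?S \<in> carrier_mat k k"
    using G cI by (intro carrier_matI) (simp_all add: dim_submatrix J)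
  obtain B where B: "?S * B = 1\<^sub>m k" "B \<in> carrier_mat k k"
  proof -
    obtain B where "inverts_mat ?S B" "inverts_mat B ?S"
      using inv by (auto simp: invertible_mat_def)
    then have *: "?S * B = 1\<^sub>m k" "B * ?S = 1\<^sub>m (dim_row B)"
      using S by (auto simp: inverts_mat_def)
    \<comment> \<open>Invertibility leaves the shape of \<open>B\<close> open; the two identity
      products fix it.\<close>
    have "dim_col B = k" using arg_cong[OF *(1), of dim_col] by simp
    moreover have "dim_row B = k" using arg_cong[OF *(2), of dim_col] S by simp
    ultimately show thesis using * that by blast
  qed
  let ?X = "Matrix.mat 1 k (\<lambda>(_, c). x c)"
  have "?X * ?S = 0\<^sub>m 1 k"
  proof (rule eq_matI)
    fix i t assume "i < dim_row (0\<^sub>m 1 k :: 'q mat)" "t < dim_col (0\<^sub>m 1 k :: 'q mat)"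
    then have it: "i = 0" "t < k" by auto
    have "(?X * ?S) $$ (i, t) = (\<Sum>c<k. x c * G $$ (c, pick I t))"
      using it S G cI J
      by (auto simp: scalar_prod_def submatrix_index pick_UNIV atLeast0LessThan intro!: sum.cong)
    also have "\<dots> = 0"
      by (rule zero) (use it cI in \<open>simp add: pick_in_set_le\<close>)
    finally show "(?X * ?S) $$ (i, t) = 0\<^sub>m 1 k $$ (i, t)" using it by simp
  qed (use S in auto)
  moreover have "?X = ?X * (?S * B)"
    unfolding B(1) by (rule right_mult_one_mat[symmetric, of _ 1]) simp
  moreover have "?X * (?S * B) = ?X * ?S * B"
    by (rule assoc_mult_mat[of _ 1 k _ k _ k, symmetric]) (use S B in simp_all)
  ultimately have "?X = 0\<^sub>m 1 k * B" by simp
  also have "\<dots> = 0\<^sub>m 1 k" using B by simp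
  finally have "?X $$ (0, c) = 0\<^sub>m 1 k $$ (0, c)" by simp
  then show ?thesis using c by simp
qed

text \<open>A nonzero row has a nonzero entry, and the column through that entry alone is linearly
  independent.\<close>

lemma rank_pos:
  fixes V :: "'q::field mat"
  assumes V: "V \<in> carrier_mat \<mu> f" and v: "v < \<mu>" "Matrix.row V v \<noteq> 0\<^sub>v f"
  shows "1 \<le> vec_space.rank \<mu> V"
proof -
  interpret vec_space "TYPE('q)" \<mu> .
  obtain m where m: "m < f" "V $$ (v, m) \<noteq> 0"
    using V v by (metis carrier_matD eq_vecI index_row(1) index_row(2) index_zero_vec)
  let ?c = "col V m"
  have c: "?c \<in> carrier_vec \<mu>" using V by auto
  have "lin_indpt {?c}"
  proof
    assume "lin_dep {?c}"
    then obtain A a w where A: "finite A" "A \<subseteq> {?c}" "lincomb a A = 0\<^sub>v \<mu>" "w \<in> A" "a w \<noteq> 0"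
      unfolding lin_dep_def by auto
    then have A': "A = {?c}" "a ?c \<noteq> 0" by auto
    have "lincomb a A $ v = a ?c * ?c $ v"
      using lincomb_index[of v A a] v c A' by simp
    then show False using A A' V v m by simp
  qed
  then have "card {?c} \<le> rank V"
    using V m by (intro rank_ge_card_indpt[OF V]) (auto simp: cols_def)
  then show ?thesis by simp
qed

text \<open>
  Over a finite field this follows by counting: the column space has at least \<open>q ^ r\<close> elements, so
  two of them agree on all rows in \<open>S\<close>.
\<close>
lemma exists_separating_direction:
  fixes V :: "'q::{field,finite} mat"
  assumes V: "V \<in> carrier_mat \<mu> f" and S: "finite S" "S \<subseteq> {..<\<mu>}" "card S < vec_space.rank \<mu> V"
  obtains v d where "v < \<mu>" "(\<Sum>m<f. V $$ (v, m) * d m) = 1"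
    "\<And>s. s \<in> S \<Longrightarrow> (\<Sum>m<f. V $$ (s, m) * d m) = 0"
proof -
  interpret vec_space "TYPE('q)" \<mu> .
  let ?P = "\<lambda>T. T \<subseteq> set (cols V) \<and> lin_indpt T"
  have "lin_indpt {}" by (auto simp: lin_dep_def)
  then obtain B where B: "finite B" "maximal B ?P"
    using maximal_exists_superset[of "set (cols V)" ?P "{}"] by blast
  then have ind: "lin_indpt B" and Bc: "B \<subseteq> set (cols V)" by (auto simp: maximal_def)
  have rB: "card B = rank V" using rank_card_indpt[OF V B(2)] by simp
  have Bcar: "B \<subseteq> carrier_vec \<mu>" using Bc cols_dim[of V] V by auto
  have "\<exists>i<f. col V i = x" if "x \<in> B" for x
  proof -
    have "x \<in> col V ` {0..<f}" using that Bc V by (auto simp: cols_def)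
    then show ?thesis by auto
  qed
  then obtain ix where ix: "\<And>x. x \<in> B \<Longrightarrow> ix x < f \<and> col V (ix x) = x" by metis
  have ix_inj: "inj_on ix B" by (rule inj_onI) (metis ix)
  \<comment> \<open>A linear combination of the basis columns in \<open>B\<close> is
    \<open>V\<close> applied to a vector supported on the chosen column indices.\<close>
  have coord: "(\<Sum>m<f. V $$ (s, m) * (if m \<in> ix ` B then a (col V m) else 0)) = lincomb a B $ s"
    if s: "s < \<mu>" for s a
  proof -
    have "(\<Sum>m<f. V $$ (s, m) * (if m \<in> ix ` B then a (col V m) else 0)) =
        (\<Sum>m\<in>ix ` B. V $$ (s, m) * a (col V m))"
      using ix by (intro sum.mono_neutral_cong_right) auto
    also have "\<dots> = (\<Sum>x\<in>B. V $$ (s, ix x) * a x)"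
      using ix by (simp add: sum.reindex[OF ix_inj])
    also have "\<dots> = (\<Sum>x\<in>B. a x * x $ s)"
    proof (intro sum.cong refl)
      fix x assume "x \<in> B"
      then have "V $$ (s, ix x) = x $ s"
        using ix[of x] V s by (metis carrier_matD index_col)
      then show "V $$ (s, ix x) * a x = a x * x $ s" by simp
    qed
    also have "\<dots> = lincomb a B $ s" by (rule lincomb_index[OF s Bcar, symmetric])
    finally show ?thesis .
  qed
  let ?D = "B \<rightarrow>\<^sub>E (UNIV :: 'q set)" and ?E = "S \<rightarrow>\<^sub>E (UNIV :: 'q set)"
  let ?F = "\<lambda>a. \<lambda>s\<in>S. lincomb a B $ s"
  have q: "2 \<le> CARD('q)"
    using card_mono[of "UNIV :: 'q set" "{0, 1}"] by simp
  \<comment> \<open>Pigeonhole: the coefficient families on \<open>B\<close> outnumber the value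
    families on \<open>S\<close>, as \<open>card S\<close> is below the rank. Two of them agree on
    \<open>S\<close>, and their difference \<open>e\<close> vanishes there.\<close>
  have "card ?E < card ?D"
    using S B q rB by (simp add: card_PiE power_strict_increasing)
  moreover have "?F ` ?D \<subseteq> ?E" by auto
  moreover have "finite ?E" using S by (simp add: finite_PiE)
  ultimately have "\<not> inj_on ?F ?D"
    by (metis card_image card_mono not_less)
  then obtain a a' where a: "a \<in> ?D" "a' \<in> ?D" "a \<noteq> a'" "?F a = ?F a'"
    by (auto simp: inj_on_def)
  define e where "e x = a x - a' x" for x
  have lc: "lincomb e B $ s = lincomb a B $ s - lincomb a' B $ s" if "s < \<mu>" for s
    by (simp add: lincomb_index[OF that Bcar] e_def left_diff_distrib sum_subtractf)
  have "\<exists>x\<in>B. a x \<noteq> a' x"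
    using a by (metis PiE_ext)
  then obtain x where x: "x \<in> B" "e x \<noteq> 0" by (auto simp: e_def)
  have "lincomb e B \<noteq> 0\<^sub>v \<mu>"
  proof
    assume "lincomb e B = 0\<^sub>v \<mu>"
    then have "lin_dep B" unfolding lin_dep_def using x B(1) by auto
    then show False using ind by simp
  qed
  then obtain v where v: "v < \<mu>" "lincomb e B $ v \<noteq> 0"
    using lincomb_dim[OF B(1) Bcar, of e] by (metis eq_vecI index_zero_vec)
  let ?y = "lincomb e B $ v"
  \<comment> \<open>By independence of \<open>B\<close> the combination with coefficients
    \<open>e\<close> is nonzero at some \<open>v\<close>; dividing by that value normalises it to 1
    and keeps the zeros on \<open>S\<close>.\<close>
  let ?d = "\<lambda>m. (if m \<in> ix ` B then e (col V m) else 0) / ?y"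
  have d: "(\<Sum>m<f. V $$ (s, m) * ?d m) = lincomb e B $ s / ?y" if "s < \<mu>" for s
    using coord[OF that, of e] by (simp add: sum_divide_distrib[symmetric])
  show thesis
  proof (rule that[of v ?d])
    show "(\<Sum>m<f. V $$ (v, m) * ?d m) = 1" using d[OF v(1)] v(2) by simp
    fix s assume s: "s \<in> S"
    then have s\<mu>: "s < \<mu>" using S by auto
    have "lincomb e B $ s = 0"
      using lc[OF s\<mu>] restrict_eqD[OF a(4) s] by simp
    then show "(\<Sum>m<f. V $$ (s, m) * ?d m) = 0" using d[OF s\<mu>] by simp
  qed (use v in simp)
qed

subsection \<open>Linear storage\<close>

text \<open>The default value 0 outside the index range makes the set finite and each element
  determined by its entries.\<close>

definition message_space :: "nat \<Rightarrow> nat \<Rightarrow> nat \<Rightarrow> 'q::{field,finite} messages set" where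
  "message_space f \<beta> k = PiE_dflt ({..<f} \<times> {..<\<beta>} \<times> {..<k}) 0 (\<lambda>_. UNIV)"

lemma messages_pmf_eq: "messages_pmf f \<beta> k = pmf_of_set (message_space f \<beta> k)"
  unfolding messages_pmf_def message_space_def by (rule Pi_pmf_of_set) auto

lemma card_message_space: "card (message_space f \<beta> k :: 'q::{field,finite} messages set) = CARD('q) ^ (f * \<beta> * k)"
  by (simp add: message_space_def card_PiE_dflt mult.assoc)

lemma one_less_card_field: "1 < CARD('q::{field,finite})"
  using card_mono[of "UNIV :: 'q set" "{0, 1}"] by simp

lemma message_space_eqI:
  assumes "w \<in> message_space f \<beta> k" "w' \<in> message_space f \<beta> k"
    and "\<And>m i c. m < f \<Longrightarrow> i < \<beta> \<Longrightarrow> c < k \<Longrightarrow> w (m, i, c) = w' (m, i, c)"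
  shows "w = w'"
proof
  fix z :: "nat \<times> nat \<times> nat"
  obtain m i c where z: "z = (m, i, c)" by (cases z) auto
  show "w z = w' z"
  proof (cases "m < f \<and> i < \<beta> \<and> c < k")
    case True
    then show ?thesis using assms(3) z by simp
  next
    case False
    then show ?thesis using assms(1,2) unfolding z by (auto simp: message_space_def PiE_dflt_def)
  qed
qed

locale linear_storage =
  fixes G V :: "'q::{field,finite} mat" and n k f \<mu> \<beta> :: nat
  assumes G: "G \<in> carrier_mat k n" and V: "V \<in> carrier_mat \<mu> f"
begin

abbreviation msgs :: "'q messages set" where
  "msgs \<equiv> message_space f \<beta> k"

sublocale finite_uniform msgs "real CARD('q)"
proof
  show "finite msgs" by (auto simp: message_space_def intro!: finite_PiE_dflt)
  show "msgs \<noteq> {}" using card_message_space[of f \<beta> k, where 'q='q] by auto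
  show "1 < real CARD('q)" using one_less_card_field[where 'q='q] by simp
qed

definition entry :: "nat \<Rightarrow> nat \<Rightarrow> nat \<Rightarrow> 'q messages \<Rightarrow> 'q" where
  "entry s i c w = (\<Sum>m<f. V $$ (s, m) * w (m, i, c))"

definition code_symbol :: "nat \<Rightarrow> nat \<Rightarrow> nat \<Rightarrow> 'q messages \<Rightarrow> 'q" where
  "code_symbol m i j w = (\<Sum>c<k. w (m, i, c) * G $$ (c, j))"

text \<open>The paper's \<open>X\<close> with superscript \<open>S\<close>: the candidate functions indexed by \<open>S\<close>.\<close>
definition known :: "nat set \<Rightarrow> 'q messages \<Rightarrow> nat \<Rightarrow> 'q list" where
  "known S w = (\<lambda>s\<in>S. candidate V \<beta> k w s)"

text \<open>The list position \<open>l\<close> and the matrix position \<open>(i, c)\<close>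
  correspond by \<open>l = i * k + c\<close>.\<close>

lemma candidate_eq_iff:
  assumes "s < \<mu>"
  shows "candidate V \<beta> k w s = candidate V \<beta> k w' s \<longleftrightarrow> (\<forall>i<\<beta>. \<forall>c<k. entry s i c w = entry s i c w')"
proof -
  have sym: "candidate_symbol V k u s l = entry s (l div k) (l mod k) u" for u l
    using V assms
    by (auto simp: candidate_symbol_def message_symbol_def entry_def scalar_prod_def atLeast0LessThan
        intro!: sum.cong)
  have "candidate V \<beta> k w s = candidate V \<beta> k w' s \<longleftrightarrow>
      (\<forall>l<\<beta> * k. entry s (l div k) (l mod k) w = entry s (l div k) (l mod k) w')"
    by (auto simp: candidate_def sym)
  also have "\<dots> \<longleftrightarrow> (\<forall>i<\<beta>. \<forall>c<k. entry s i c w = entry s i c w')"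
  proof (intro iffI allI impI)
    fix i c
    assume eq: "\<forall>l<\<beta> * k. entry s (l div k) (l mod k) w = entry s (l div k) (l mod k) w'"
      and i: "i < \<beta>" and c: "c < k"
    have "i * k + c < Suc i * k" using c by simp
    also have "\<dots> \<le> \<beta> * k" using i by (intro mult_le_mono1) simp
    finally show "entry s i c w = entry s i c w'"
      using eq[rule_format, of "i * k + c"] c by simp
  next
    fix l
    assume eq: "\<forall>i<\<beta>. \<forall>c<k. entry s i c w = entry s i c w'" and l: "l < \<beta> * k"
    then have "0 < k" by (cases k) auto
    then show "entry s (l div k) (l mod k) w = entry s (l div k) (l mod k) w'"
      using eq l by (simp add: less_mult_imp_div_less)
  qed
  finally show ?thesis .
qed

lemma stored_content_eq_iff:
  assumes "j < n"
  shows "stored_content G f \<beta> w j = stored_content G f \<beta> w' j \<longleftrightarrow>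
    (\<forall>m<f. \<forall>i<\<beta>. code_symbol m i j w = code_symbol m i j w')"
proof -
  have sym: "col (message_matrix \<beta> (dim_row G) u m * G) j $ i = code_symbol m i j u" if "i < \<beta>" for u m i
    using G assms that
    by (auto simp: message_matrix_def code_symbol_def scalar_prod_def atLeast0LessThan intro!: sum.cong)
  have dim: "dim_vec (col (message_matrix \<beta> (dim_row G) u m * G) j) = \<beta>" for u m
    by (simp add: message_matrix_def)
  have "col (message_matrix \<beta> (dim_row G) w m * G) j = col (message_matrix \<beta> (dim_row G) w' m * G) j
      \<longleftrightarrow> (\<forall>i<\<beta>. code_symbol m i j w = code_symbol m i j w')" for m
    unfolding vec_eq_iff dim using sym by metis
  then show ?thesis
    unfolding stored_content_def map_eq_conv by auto
qed

lemma known_eq_iff: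
  assumes "S \<subseteq> {..<\<mu>}"
  shows "known S w = known S w' \<longleftrightarrow> (\<forall>s\<in>S. \<forall>i<\<beta>. \<forall>c<k. entry s i c w = entry s i c w')"
  unfolding known_def restrict_eq_iff using assms by (intro ball_cong refl candidate_eq_iff) auto

text \<open>A database holds \<open>f * \<beta>\<close> field symbols, each worth at most one q-ary
  unit.\<close>

lemma H_stored_content_le:
  assumes j: "j < n"
  shows "H (\<lambda>w. stored_content G f \<beta> w j) \<le> real (f * \<beta>)"
proof -
  let ?D = "{..<f} \<times> {..<\<beta>}"
  let ?h = "\<lambda>w. \<lambda>z\<in>?D. code_symbol (fst z) (snd z) j w"
  have "H (\<lambda>w. stored_content G f \<beta> w j) = H ?h"
  proof (rule H_eqI)
    fix w w'
    have "?h w = ?h w' \<longleftrightarrow> (\<forall>z\<in>?D. code_symbol (fst z) (snd z) j w = code_symbol (fst z) (snd z) j w')"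
      by (rule restrict_eq_iff)
    then show "stored_content G f \<beta> w j = stored_content G f \<beta> w' j \<longleftrightarrow> ?h w = ?h w'"
      unfolding stored_content_eq_iff[OF j] by auto
  qed
  also have "\<dots> \<le> log (real CARD('q)) (real (card (?D \<rightarrow>\<^sub>E (UNIV :: 'q set))))"
  proof (rule H_le_log_card)
    show "?h ` msgs \<subseteq> ?D \<rightarrow>\<^sub>E (UNIV :: 'q set)" by (intro image_subsetI restrict_PiE_iff[THEN iffD2]) simp
    show "finite (?D \<rightarrow>\<^sub>E (UNIV :: 'q set))" by (simp add: finite_PiE)
  qed
  also have "\<dots> = real (f * \<beta>)"
    using base by (simp add: card_PiE log_nat_power)
  finally show ?thesis .
qed

text \<open>
  An information set determines the messages, and column \<open>j\<close> of an encoded candidate function is a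
  function both of the candidate function and of the content of database \<open>j\<close>.
\<close>
lemma information_set_entropy:
  assumes I: "information_set G I" and S: "S \<subseteq> {..<\<mu>}"
  shows "(\<Sum>j\<in>I. Hc (\<lambda>w. a j (stored_content G f \<beta> w j)) (known S))
    \<le> Hc (\<lambda>w. \<lambda>j\<in>I. a j (stored_content G f \<beta> w j)) (known S)"
proof -
  have In: "I \<subseteq> {..<n}" and cI: "card I = k" using I G by (auto simp: information_set_def)
  have fin: "finite I" using In finite_subset by blast
  have code_inj: "x c = y c" if "\<And>j. j \<in> I \<Longrightarrow> (\<Sum>c<k. x c * G $$ (c, j)) = (\<Sum>c<k. y c * G $$ (c, j))" "c < k" for x y c
  proof -
    have "x c - y c = 0"
      by (rule information_set_zero[OF G I _ that(2), of "\<lambda>c. x c - y c"])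
        (simp add: left_diff_distrib sum_subtractf that(1))
    then show ?thesis by simp
  qed
  define \<psi> where "\<psi> j w = (\<lambda>z\<in>S \<times> {..<\<beta>}. \<Sum>c<k. entry (fst z) (snd z) c w * G $$ (c, j))" for j w
  \<comment> \<open>Combining messages commutes with encoding: the left side depends on the
    candidate functions only, the right side on the content of database \<open>j\<close>
    only.\<close>
  have \<psi>_swap: "(\<Sum>c<k. entry s i c w * G $$ (c, j)) = (\<Sum>m<f. V $$ (s, m) * code_symbol m i j w)" for s i w j
    by (simp add: entry_def code_symbol_def sum_distrib_left sum_distrib_right mult.assoc) (rule sum.swap)
  show ?thesis
  proof (rule Hc_family_ge[OF fin, where C = "\<lambda>j w. stored_content G f \<beta> w j" and \<psi> = \<psi>])
    show "inj_on (\<lambda>w. \<lambda>j\<in>I. stored_content G f \<beta> w j) msgs"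
    proof (rule inj_onI)
      fix w w' assume w: "w \<in> msgs" "w' \<in> msgs"
        and eq: "(\<lambda>j\<in>I. stored_content G f \<beta> w j) = (\<lambda>j\<in>I. stored_content G f \<beta> w' j)"
      have code: "code_symbol m i j w = code_symbol m i j w'" if "j \<in> I" "m < f" "i < \<beta>" for m i j
        using restrict_eqD[OF eq that(1)] stored_content_eq_iff[of j w w'] that In by auto
      show "w = w'"
      proof (rule message_space_eqI[OF w])
        fix m i c assume "m < f" "i < \<beta>" "c < k"
        then show "w (m, i, c) = w' (m, i, c)"
          using code_inj[of "\<lambda>c. w (m, i, c)" "\<lambda>c. w' (m, i, c)" c] code
          by (simp add: code_symbol_def)
      qed
    qed
    \<comment> \<open>The \<open>k\<close> databases hold \<open>f * \<beta>\<close> symbols each,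
      exactly as many in total as the messages have.\<close>
    have "(\<Sum>j\<in>I. H (\<lambda>w. stored_content G f \<beta> w j)) \<le> (\<Sum>j\<in>I. real (f * \<beta>))"
      using In by (intro sum_mono H_stored_content_le) auto
    also have "\<dots> = log (real CARD('q)) (real (card msgs))"
      using base cI by (simp add: card_message_space log_nat_power)
    finally show "(\<Sum>j\<in>I. H (\<lambda>w. stored_content G f \<beta> w j)) \<le> log (real CARD('q)) (real (card msgs))" .
    show "\<psi> j w = \<psi> j w'" if "j \<in> I" "stored_content G f \<beta> w j = stored_content G f \<beta> w' j" for j w w'
    proof -
      have "code_symbol m i j w = code_symbol m i j w'" if "m < f" "i < \<beta>" for m i
        using \<open>j \<in> I\<close> \<open>stored_content G f \<beta> w j = _\<close> stored_content_eq_iff[of j w w'] that In by auto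
      then show ?thesis unfolding \<psi>_def \<psi>_swap by (intro restrict_ext sum.cong) auto
    qed
    show "\<psi> j w = \<psi> j w'" if "known S w = known S w'" for j w w'
      using that unfolding known_eq_iff[OF S] \<psi>_def by (intro restrict_ext sum.cong) auto
    show "known S w = known S w'" if eq: "\<And>j. j \<in> I \<Longrightarrow> \<psi> j w = \<psi> j w'" for w w'
      unfolding known_eq_iff[OF S]
    proof (intro ballI allI impI)
      fix s i c assume s: "s \<in> S" "i < \<beta>" and c: "c < k"
      show "entry s i c w = entry s i c w'"
      proof (rule code_inj[OF _ c])
        fix j assume "j \<in> I"
        from restrict_eqD[OF eq[OF this, unfolded \<psi>_def], of "(s, i)"] s
        show "(\<Sum>c<k. entry s i c w * G $$ (c, j)) = (\<Sum>c<k. entry s i c w' * G $$ (c, j))" by simp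
      qed
    qed
  qed simp
qed

text \<open>Moving the messages along \<open>d\<close> by an arbitrary family \<open>t\<close> of
  \<open>\<beta> * k\<close> scalars fixes \<open>known S\<close> and adds \<open>t\<close> to
  candidate function \<open>v\<close>. Each fibre of \<open>known S\<close> thus contains an
  injective image of all \<open>t\<close> paired with a fibre of
  \<open>known (insert v S)\<close>.\<close>

lemma known_insert_entropy:
  assumes S: "S \<subseteq> {..<\<mu>}" and v: "v < \<mu>"
    and d_v: "(\<Sum>m<f. V $$ (v, m) * d m) = 1"
    and d_S: "\<And>s. s \<in> S \<Longrightarrow> (\<Sum>m<f. V $$ (s, m) * d m) = 0"
  shows "H (known S) + real (\<beta> * k) \<le> H (known (insert v S))"
proof -
  have vS: "insert v S \<subseteq> {..<\<mu>}" using S v by auto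
  let ?T = "PiE_dflt ({..<\<beta>} \<times> {..<k}) (0 :: 'q) (\<lambda>_. UNIV)"
  have fT: "finite ?T" by (auto intro!: finite_PiE_dflt)
  have cT: "card ?T = CARD('q) ^ (\<beta> * k)" by (simp add: card_PiE_dflt)
  define shift where "shift = (\<lambda>(t, w :: 'q messages) (m, i, c).
    if m < f \<and> i < \<beta> \<and> c < k then w (m, i, c) + t (i, c) * d m else 0)"
  have shift_msgs: "shift z \<in> msgs" for z
    by (auto simp: shift_def message_space_def PiE_dflt_def split: prod.splits)
  have entry_shift: "entry s i c (shift (t, w)) = entry s i c w + t (i, c) * (\<Sum>m<f. V $$ (s, m) * d m)"
    if "i < \<beta>" "c < k" for s i c t w
    using that by (simp add: entry_def shift_def distrib_left sum.distrib sum_distrib_left mult.left_commute)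
  have "CARD('q) ^ (\<beta> * k) * card (fibre (known (insert v S)) w) \<le> card (fibre (known S) w)"
    if w: "w \<in> msgs" for w
  proof -
    have "inj_on shift (?T \<times> fibre (known (insert v S)) w)"
    proof (rule inj_onI)
      fix y y' assume y: "y \<in> ?T \<times> fibre (known (insert v S)) w" "y' \<in> ?T \<times> fibre (known (insert v S)) w"
        and eq: "shift y = shift y'"
      obtain t u where tu: "y = (t, u)" by (cases y)
      obtain t' u' where tu': "y' = (t', u')" by (cases y')
      have u: "u \<in> msgs" "u' \<in> msgs" "known (insert v S) u = known (insert v S) u'"
        using y tu tu' by (auto simp: fibre_def)
      \<comment> \<open>\<open>u\<close> and \<open>u'\<close> agree in candidate function
        \<open>v\<close>, which the shift changes by exactly \<open>t\<close>, so \<open>t\<close>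
        can be read off.\<close>
      have t_eq: "t (i, c) = t' (i, c)" if "i < \<beta>" "c < k" for i c
      proof -
        have "entry v i c (shift y) = entry v i c (shift y')" by (simp only: eq)
        moreover have "entry v i c u = entry v i c u'"
          using u(3) that unfolding known_eq_iff[OF vS] by blast
        ultimately show ?thesis
          unfolding tu tu' entry_shift[OF that] d_v by simp
      qed
      have "t = t'"
      proof
        fix z :: "nat \<times> nat"
        obtain i c where z: "z = (i, c)" by (cases z)
        show "t z = t' z"
          using t_eq[of i c] y tu tu' unfolding z
          by (cases "i < \<beta> \<and> c < k") (auto simp: PiE_dflt_def)
      qed
      moreover have "u = u'"
      proof (rule message_space_eqI[OF u(1,2)])
        fix m i c assume mic: "m < f" "i < \<beta>" "c < k"
        have "shift y (m, i, c) = shift y' (m, i, c)" by (simp only: eq)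
        then show "u (m, i, c) = u' (m, i, c)"
          using mic t_eq by (simp add: shift_def tu tu')
      qed
      ultimately show "y = y'" by (simp add: tu tu')
    qed
    then have "card (?T \<times> fibre (known (insert v S)) w) = card (shift ` (?T \<times> fibre (known (insert v S)) w))"
      by (rule card_image[symmetric])
    also have "\<dots> \<le> card (fibre (known S) w)"
    proof (rule card_mono[OF finite_fibre])
      show "shift ` (?T \<times> fibre (known (insert v S)) w) \<subseteq> fibre (known S) w"
      proof (rule image_subsetI)
        fix y assume "y \<in> ?T \<times> fibre (known (insert v S)) w"
        then obtain t u where y: "y = (t, u)" and "u \<in> fibre (known (insert v S)) w" by auto
        then have "known (insert v S) u = known (insert v S) w" by (simp add: fibre_def)
        then have "known S (shift y) = known S w"
          unfolding known_eq_iff[OF S] known_eq_iff[OF vS] y by (simp add: entry_shift d_S)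
        then show "shift y \<in> fibre (known S) w" using shift_msgs by (simp add: fibre_def)
      qed
    qed
    finally show ?thesis by (simp add: card_cartesian_product cT)
  qed
  from H_fibre_ratio[OF _ this] show ?thesis
    using base by (simp add: log_nat_power)
qed

end

subsection \<open>The converse bound\<close>

text \<open>\<open>D\<close> may be infinite, as a download cost can be; the left side is then
  0.\<close>

lemma divide_left_mono_ennreal:
  assumes "ennreal d \<le> D" "0 < d"
  shows "c / D \<le> c / ennreal d"
proof -
  have "inverse D \<le> inverse (ennreal d)"
    using assms by (cases D) (auto simp: inverse_ennreal le_imp_inverse_le)
  then show ?thesis
    unfolding divide_ennreal_def by (rule mult_left_mono) simp
qed

section \<open>One step of the bound for fixed queries\<close>

context linear_storage
begin

text \<open>Privacy speaks of the list of all candidate functions; \<open>known S\<close> is a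
  function of that list.\<close>

lemma known_cong_candidates:
  assumes "S \<subseteq> {..<\<mu>}"
  shows "known S w = (\<lambda>s\<in>S. candidates V \<beta> k w ! s)"
  unfolding known_def using assms V by (intro restrict_ext) (auto simp: candidates_def)

text \<open>Here \<open>a j\<close> is the answer function of database \<open>j\<close> once its
  query is fixed. Recovery lets \<open>candidate\<close> function \<open>v\<close> join the
  condition at a gain of \<open>\<beta> * k\<close>, and averaging over information sets returns to
  single databases.\<close>

lemma capacity_step:
  assumes MDS: "MDS_PIR_capacity_achieving G" and n: "0 < n"
    and S: "S \<subseteq> {..<\<mu>}" and v: "v < \<mu>"
    and d_v: "(\<Sum>m<f. V $$ (v, m) * d m) = 1"
    and d_S: "\<And>s. s \<in> S \<Longrightarrow> (\<Sum>m<f. V $$ (s, m) * d m) = 0"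
    and recover: "\<And>w w'. w \<in> msgs \<Longrightarrow> w' \<in> msgs \<Longrightarrow>
      (\<And>j. j < n \<Longrightarrow> a j (stored_content G f \<beta> w j) = a j (stored_content G f \<beta> w' j)) \<Longrightarrow>
      candidate V \<beta> k w v = candidate V \<beta> k w' v"
  shows "real (\<beta> * k) + real k / real n * (\<Sum>j<n. Hc (\<lambda>w. a j (stored_content G f \<beta> w j)) (known (insert v S)))
    \<le> (\<Sum>j<n. Hc (\<lambda>w. a j (stored_content G f \<beta> w j)) (known S))"
proof -
  let ?a = "\<lambda>j w. a j (stored_content G f \<beta> w j)"
  let ?A = "\<lambda>w. \<lambda>j\<in>{..<n}. ?a j w" and ?X = "known S" and ?Y = "known (insert v S)"
  have vS: "insert v S \<subseteq> {..<\<mu>}" using S v by simp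
  obtain \<kappa> \<nu> \<Lambda> where \<Lambda>: "0 < \<nu>" "PIR_achievable_rate_matrix G \<kappa> \<nu> \<Lambda>"
    "real \<kappa> / real \<nu> = real (dim_row G) / real (dim_col G)"
    using MDS unfolding MDS_PIR_capacity_achieving_def by blast
  have "real (dim_row G) / real (dim_col G) * (\<Sum>j<dim_col G. Hc (?a j) ?Y) \<le> Hc ?A ?Y"
  proof (rule rate_matrix_average[OF \<Lambda>(2,1) _ \<Lambda>(3)])
    show "0 < dim_col G" using n G by simp
    fix I assume I: "information_set G I"
    then have In: "I \<subseteq> {..<n}" using G by (auto simp: information_set_def)
    have "(\<Sum>j\<in>I. Hc (?a j) ?Y) \<le> Hc (\<lambda>w. \<lambda>j\<in>I. ?a j w) ?Y"
      by (rule information_set_entropy[OF I vS])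
    also have "\<dots> \<le> Hc ?A ?Y"
      using In by (intro Hc_mono) (auto simp only: restrict_eq_iff)
    finally show "(\<Sum>j\<in>I. Hc (?a j) ?Y) \<le> Hc ?A ?Y" .
  qed
  then have avg: "real k / real n * (\<Sum>j<n. Hc (?a j) ?Y) \<le> Hc ?A ?Y"
    using G by simp
  \<comment> \<open>By recovery, all answers together with \<open>?X\<close> determine
    \<open>?Y\<close>.\<close>
  have "H (\<lambda>w. (?A w, ?Y w)) \<le> H (\<lambda>w. (?A w, ?X w))"
  proof (rule H_mono)
    fix w w' assume w: "w \<in> msgs" "w' \<in> msgs" and eq: "(?A w, ?X w) = (?A w', ?X w')"
    have "?a j w = ?a j w'" if "j < n" for j
      using eq that by (simp only: prod.inject restrict_eq_iff lessThan_iff)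
    then have "candidate V \<beta> k w v = candidate V \<beta> k w' v"
      by (rule recover[OF w])
    then have "?Y w = ?Y w'"
      using eq unfolding prod.inject known_def restrict_eq_iff by blast
    then show "(?A w, ?Y w) = (?A w', ?Y w')" using eq by (simp only: prod.inject)
  qed
  then have "Hc ?A ?Y + (H ?Y - H ?X) \<le> Hc ?A ?X"
    by (simp only: Hc_def)
  moreover have "H ?X + real (\<beta> * k) \<le> H ?Y"
    using S v d_v d_S by (rule known_insert_entropy)
  moreover have "Hc ?A ?X \<le> (\<Sum>j<n. Hc (?a j) ?X)"
    by (rule Hc_family_le) simp
  ultimately show ?thesis using avg by linarith
qed

end

section \<open>Entropies of the answers of a protocol\<close>

locale plc_scheme = linear_storage G V n k f \<mu> "num_rows P"
  for G V :: "'q::{field,finite} mat" and n k f \<mu> and P :: "'q plc_protocol" +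
  assumes protocol: "is_plc_protocol G V P" and n_pos: "0 < n"
    and MDS: "MDS_PIR_capacity_achieving G"
begin

abbreviation content :: "nat \<Rightarrow> 'q messages \<Rightarrow> 'q Matrix.vec list" where
  "content j w \<equiv> stored_content G f (num_rows P) w j"

text \<open>\<open>residual S v j\<close> is \<open>H(A_j | Q_j, X\<^sup>S)\<close> when \<open>v\<close> is desired.\<close>
definition residual :: "nat set \<Rightarrow> nat \<Rightarrow> nat \<Rightarrow> ennreal" where
  "residual S v j = (\<integral>\<^sup>+qs. ennreal (Hc (\<lambda>w. answer P v j (qs ! j) (content j w)) (known S)) \<partial>measure_pmf (queries P v))"

lemma plc_pmf_eq: "plc_pmf G V P v = pair_pmf U (queries P v)"
  using G V by (simp add: plc_pmf_def messages_pmf_eq)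

lemma set_plc_pmf: "set_pmf (plc_pmf G V P v) = msgs \<times> set_pmf (queries P v)"
  using finite_space nonempty by (simp add: plc_pmf_eq)

text \<open>The integrand depends on the queries only through the one to database \<open>j\<close>,
  and on \<open>v\<close> only through the joint law of answer and candidate functions given that
  query. Privacy makes both ingredients independent of \<open>v\<close>.\<close>

lemma residual_private:
  assumes S: "S \<subseteq> {..<\<mu>}" and v: "v < \<mu>" "v' < \<mu>" and j: "j < n"
  shows "residual S v j = residual S v' j"
proof (cases "v = v'")
  case False
  let ?Q = "\<lambda>v. map_pmf (\<lambda>qs. qs ! j) (queries P v)"
  let ?K = "\<lambda>v y. map_pmf (\<lambda>w. (answer P v j y (content j w), candidates V (num_rows P) k w)) U"
  have joint: "map_pmf (\<lambda>\<omega>. (query_rv j \<omega>, answer_rv G V P v j \<omega>, candidates V (num_rows P) (dim_row G) (fst \<omega>)))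
      (plc_pmf G V P v) = bind_pmf (?Q v) (\<lambda>y. map_pmf (Pair y) (?K v y))" for v
    unfolding plc_pmf_eq using G V
    by (subst pair_commute_pmf)
      (simp add: pair_pmf_def map_pmf_def bind_assoc_pmf bind_return_pmf query_rv_def answer_rv_def)
  have "bind_pmf (?Q v) (\<lambda>y. map_pmf (Pair y) (?K v y)) = bind_pmf (?Q v') (\<lambda>y. map_pmf (Pair y) (?K v' y))"
  proof -
    have "plc_private G V P" using protocol by (simp add: is_plc_protocol_def)
    moreover have "v < dim_row V" "v' < dim_row V" "j < dim_col G" using v j V G by simp_all
    ultimately show ?thesis
      using False unfolding plc_private_def joint[symmetric] by blast
  qed
  note eq = bind_map_Pair_eqD[OF this]
  have Hc_eq: "Hc (\<lambda>w. answer P v j y (content j w)) (known S) = Hc (\<lambda>w. answer P v' j y (content j w)) (known S)"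
    if "y \<in> set_pmf (?Q v)" for y
  proof -
    have "map_pmf (\<lambda>w. (answer P u j y (content j w), known S w)) U =
        map_pmf (\<lambda>(x, c). (x, \<lambda>s\<in>S. c ! s)) (?K u y)" for u
      by (simp add: map_pmf_comp known_cong_candidates[OF S])
    then have "map_pmf (\<lambda>w. (answer P v j y (content j w), known S w)) U =
        map_pmf (\<lambda>w. (answer P v' j y (content j w), known S w)) U"
      using eq(2)[OF that] by simp
    then have "H (\<lambda>w. (answer P v j y (content j w), known S w)) = H (\<lambda>w. (answer P v' j y (content j w), known S w))"
      by (rule H_distr_cong)
    then show ?thesis by (simp only: Hc_def)
  qed
  have res: "residual S u j = (\<integral>\<^sup>+y. ennreal (Hc (\<lambda>w. answer P u j y (content j w)) (known S)) \<partial>measure_pmf (?Q u))" for u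
    by (simp add: residual_def)
  show ?thesis
    unfolding res eq(1)[symmetric]
    by (intro nn_integral_cong_AE AE_pmfI) (simp only: Hc_eq)
qed simp

text \<open>Recovery as a deterministic statement for every query list of positive probability:
  messages and queries are independent, so both \<open>(w, qs)\<close> and \<open>(w', qs)\<close>
  lie in the support.\<close>

lemma recoverable:
  assumes v: "v < \<mu>" and qs: "qs \<in> set_pmf (queries P v)" and w: "w \<in> msgs" "w' \<in> msgs"
    and eq: "\<And>j. j < n \<Longrightarrow> answer P v j (qs ! j) (content j w) = answer P v j (qs ! j) (content j w')"
  shows "candidate V (num_rows P) k w v = candidate V (num_rows P) k w' v"
proof -
  let ?X = "\<lambda>\<omega>. candidate V (num_rows P) (dim_row G) (fst \<omega>) v"
  let ?Y = "\<lambda>\<omega>. (map (\<lambda>j. answer_rv G V P v j \<omega>) [0..<dim_col G], map (\<lambda>j. query_rv j \<omega>) [0..<dim_col G])"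
  have "?X (w, qs) = ?X (w', qs)"
  proof (rule shannon_cond_entropy_eq_0D[OF base, where M = "plc_pmf G V P v" and Y = ?Y])
    show "shannon_cond_entropy (real CARD('q)) (plc_pmf G V P v) ?X ?Y = 0"
    proof -
      have "plc_recoverable G V P" using protocol by (simp add: is_plc_protocol_def)
      moreover have "v < dim_row V" using v V by simp
      ultimately show ?thesis unfolding plc_recoverable_def by blast
    qed
    have "?X ` set_pmf (plc_pmf G V P v) \<subseteq> (\<lambda>w. candidate V (num_rows P) (dim_row G) w v) ` msgs"
      by (auto simp: set_plc_pmf)
    then show "finite (?X ` set_pmf (plc_pmf G V P v))"
      using finite_space finite_surj by blast
    show "(w, qs) \<in> set_pmf (plc_pmf G V P v)" "(w', qs) \<in> set_pmf (plc_pmf G V P v)"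
      using w qs by (simp_all add: set_plc_pmf)
    show "?Y (w, qs) = ?Y (w', qs)"
      using eq G V by (auto simp: answer_rv_def query_rv_def)
  qed
  then show ?thesis using G by simp
qed

text \<open>The inequality for fixed queries is integrated over the queries; the constant term
  survives because the total mass is 1.\<close>

lemma residual_step:
  assumes S: "S \<subseteq> {..<\<mu>}" and v: "v < \<mu>"
    and d_v: "(\<Sum>m<f. V $$ (v, m) * d m) = 1"
    and d_S: "\<And>s. s \<in> S \<Longrightarrow> (\<Sum>m<f. V $$ (s, m) * d m) = 0"
  shows "ennreal (real (num_rows P * k)) + ennreal (real k / real n) * (\<Sum>j<n. residual (insert v S) v j)
    \<le> (\<Sum>j<n. residual S v j)"
proof -
  let ?h = "\<lambda>S qs j. Hc (\<lambda>w. answer P v j (qs ! j) (content j w)) (known S)"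
  let ?M = "measure_pmf (queries P v)"
  have sum_eq: "(\<Sum>j<n. residual S v j) = (\<integral>\<^sup>+qs. ennreal (\<Sum>j<n. ?h S qs j) \<partial>?M)" for S
    by (simp add: residual_def nn_integral_sum[symmetric] sum_ennreal Hc_nonneg)
  have "ennreal (real (num_rows P * k)) + ennreal (real k / real n) * (\<Sum>j<n. residual (insert v S) v j) =
      (\<integral>\<^sup>+qs. ennreal (real (num_rows P * k) + real k / real n * (\<Sum>j<n. ?h (insert v S) qs j)) \<partial>?M)"
  proof -
    have "ennreal c + ennreal x * (\<integral>\<^sup>+qs. ennreal (h qs) \<partial>?M) = (\<integral>\<^sup>+qs. ennreal (c + x * h qs) \<partial>?M)"
      if "0 \<le> c" "0 \<le> x" "\<And>qs. 0 \<le> h qs" for c x h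
      using that by (simp add: ennreal_plus ennreal_mult nn_integral_add nn_integral_cmult
          measure_pmf.emeasure_space_1)
    then show ?thesis unfolding sum_eq by (simp add: sum_nonneg Hc_nonneg)
  qed
  also have "\<dots> \<le> (\<Sum>j<n. residual S v j)"
    unfolding sum_eq
  proof (intro nn_integral_mono_AE AE_pmfI ennreal_leI)
    fix qs assume qs: "qs \<in> set_pmf (queries P v)"
    show "real (num_rows P * k) + real k / real n * (\<Sum>j<n. ?h (insert v S) qs j) \<le> (\<Sum>j<n. ?h S qs j)"
      by (rule capacity_step[OF MDS n_pos S v d_v d_S, where a = "\<lambda>j. answer P v j (qs ! j)"])
        (assumption | rule recoverable[OF v qs])+
  qed
  finally show ?thesis .
qed

text \<open>Here \<open>t\<close> counts the remaining steps, for which the rank must leave room.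
  The desired function stays general in the induction because every step selects a new one.\<close>

lemma residual_lower_bound:
  assumes "S \<subseteq> {..<\<mu>}" "v < \<mu>" "card S + t \<le> vec_space.rank \<mu> V"
  shows "ennreal (real (num_rows P * k) * (\<Sum>i<t. (real k / real n) ^ i)) \<le> (\<Sum>j<n. residual S v j)"
  using assms
proof (induction t arbitrary: S v)
  case (Suc t)
  let ?\<rho> = "real k / real n" and ?L = "real (num_rows P * k)"
  have fin: "finite S" using Suc.prems(1) finite_subset by blast
  obtain u d where u: "u < \<mu>" and d: "(\<Sum>m<f. V $$ (u, m) * d m) = 1"
    "\<And>s. s \<in> S \<Longrightarrow> (\<Sum>m<f. V $$ (s, m) * d m) = 0"
    by (rule exists_separating_direction[OF V fin Suc.prems(1)]) (use Suc.prems(3) in auto)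
  have "u \<notin> S" using d by force
  then have "card (insert u S) + t \<le> vec_space.rank \<mu> V" using Suc.prems(3) fin by simp
  then have IH: "ennreal (?L * (\<Sum>i<t. ?\<rho> ^ i)) \<le> (\<Sum>j<n. residual (insert u S) u j)"
    using Suc.prems(1) u by (intro Suc.IH) auto
  have "ennreal (?L * (\<Sum>i<Suc t. ?\<rho> ^ i)) = ennreal ?L + ennreal ?\<rho> * ennreal (?L * (\<Sum>i<t. ?\<rho> ^ i))"
  proof -
    have "?L * (\<Sum>i<Suc t. ?\<rho> ^ i) = ?L + ?\<rho> * (?L * (\<Sum>i<t. ?\<rho> ^ i))"
      by (simp add: sum.lessThan_Suc_shift sum_distrib_left algebra_simps del: sum.lessThan_Suc)
    moreover have "ennreal (c + x * y) = ennreal c + ennreal x * ennreal y"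
      if "0 \<le> c" "0 \<le> x" "0 \<le> y" for c x y
      using that by (simp add: ennreal_plus ennreal_mult)
    ultimately show ?thesis by (simp only: sum_nonneg mult_nonneg_nonneg divide_nonneg_nonneg of_nat_0_le_iff zero_le_power)
  qed
  also have "\<dots> \<le> ennreal ?L + ennreal ?\<rho> * (\<Sum>j<n. residual (insert u S) u j)"
    by (intro add_left_mono mult_left_mono IH) simp
  also have "\<dots> \<le> (\<Sum>j<n. residual S u j)"
    by (rule residual_step[OF Suc.prems(1) u d])
  \<comment> \<open>Privacy replaces the function \<open>u\<close> chosen for this step by the given
    \<open>v\<close>.\<close>
  also have "\<dots> = (\<Sum>j<n. residual S v j)"
    using residual_private[OF Suc.prems(1) u Suc.prems(2)] by simp
  finally show ?case .
qed simp

text \<open>With \<open>known {}\<close> constant, only the conditioning on the queries remains, and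
  dropping it can only increase the entropy.\<close>

lemma residual_le_download_cost: "(\<Sum>j<n. residual {} v j) \<le> download_cost G V P v"
proof -
  have const: "known {} = (\<lambda>_ _. undefined)" by (simp add: known_def restrict_def fun_eq_iff)
  have "residual {} v j \<le> shannon_entropy (real CARD('q)) (map_pmf (answer_rv G V P v j) (plc_pmf G V P v))" for j
  proof -
    have "answer_rv G V P v j = (\<lambda>(w, qs). answer P v j (qs ! j) (content j w))"
      using V by (simp add: answer_rv_def)
    then show ?thesis
      using shannon_entropy_mixture[where g = "\<lambda>qs w. answer P v j (qs ! j) (content j w)" and Q = "queries P v"]
      by (simp only: residual_def const Hc_const plc_pmf_eq)
  qed
  then show ?thesis
    using G by (auto simp: download_cost_def intro!: sum_mono)
qed

text \<open>A symbol takes at most q values. An upper bound is the useful direction, as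
  \<open>H_min\<close> stands in the numerator of the rate.\<close>

lemma H_min_le_1:
  assumes "v < \<mu>"
  shows "H_min G V P \<le> 1"
proof -
  let ?g = "\<lambda>w. candidate_symbol V (dim_row G) w v 0"
  have "H_min G V P \<le> shannon_entropy (real CARD('q)) (map_pmf ?g U)"
    using assms G V unfolding H_min_def by (intro Min_le) (auto simp: messages_pmf_eq)
  also have "\<dots> = ennreal (H ?g)" by (rule shannon_entropy_uniform)
  also have "\<dots> \<le> ennreal (log (real CARD('q)) (real (card (UNIV :: 'q set))))"
    by (intro ennreal_leI H_le_log_card) auto
  also have "\<dots> = 1" using base by simp
  finally show ?thesis .
qed

lemma rate_bound:
  assumes v: "v < \<mu>" and k: "0 < k" and r: "1 \<le> vec_space.rank \<mu> V"
  shows "plc_rate G V P v \<le> ennreal (1 / (\<Sum>i<vec_space.rank \<mu> V. (real k / real n) ^ i))"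
proof -
  let ?s = "\<Sum>i<vec_space.rank \<mu> V. (real k / real n) ^ i" and ?L = "real (num_rows P * k)"
  have L: "0 < ?L" using k protocol by (simp add: is_plc_protocol_def)
  \<comment> \<open>The term of index 0 equals 1 and is present because the rank is at least
    1.\<close>
  have s: "0 < ?s"
    using r by (intro sum_pos2[of _ 0]) auto
  have "ennreal (?L * ?s) \<le> (\<Sum>j<n. residual {} v j)"
    using v by (intro residual_lower_bound) auto
  also note residual_le_download_cost
  finally have D: "ennreal (?L * ?s) \<le> download_cost G V P v" .
  have "plc_rate G V P v = ennreal ?L * H_min G V P / download_cost G V P v"
    using G by (simp add: plc_rate_def ennreal_of_nat_eq_real_of_nat)
  also have "\<dots> \<le> ennreal ?L * 1 / download_cost G V P v"
    by (intro divide_right_mono_ennreal mult_left_mono H_min_le_1[OF v]) simp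
  also have "\<dots> \<le> ennreal ?L * 1 / ennreal (?L * ?s)"
    by (rule divide_left_mono_ennreal[OF D]) (use L s in simp)
  also have "\<dots> = ennreal (1 / ?s)"
    using L s divide_ennreal[of ?L "?L * ?s"] by (simp del: of_nat_mult)
  finally show ?thesis .
qed

end

theorem theorem3:
  fixes G V :: "'q::{field,finite} mat" and n k f \<mu> r :: nat
  assumes "generator_matrix n k G"
    and "MDS_PIR_capacity_achieving G"
    and "1 \<le> \<mu>"
    and "V \<in> carrier_mat \<mu> f"
    and "\<forall>v<\<mu>. Matrix.row V v \<noteq> 0\<^sub>v f"
    and "vec_space.rank \<mu> V = r"
  shows "plc_capacity G V \<le> ennreal (1 / (1 + (\<Sum>v = 1..r - 1. (real k / real n) ^ v))) \<and>
    (k < n \<longrightarrow>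
      1 / (1 + (\<Sum>v = 1..r - 1. (real k / real n) ^ v)) =
      (1 - real k / real n) * inverse (1 - (real k / real n) ^ r))"
proof -
  have G: "G \<in> carrier_mat k n" and k: "0 < k"
    using assms(1) by (auto simp: generator_matrix_def)
  have r: "1 \<le> r"
    using rank_pos[OF assms(4), of 0] assms(3,5,6) by auto
  have n: "0 < n"
  proof -
    obtain \<kappa> \<nu> \<Lambda> where "0 < \<nu>" "PIR_achievable_rate_matrix G \<kappa> \<nu> \<Lambda>"
      using assms(2) unfolding MDS_PIR_capacity_achieving_def by blast
    then obtain I where "information_set G I"
      unfolding PIR_achievable_rate_matrix_def by blast
    then have "I \<subseteq> {..<n}" "card I = k" using G by (auto simp: information_set_def)
    then show ?thesis using k by (cases n) auto
  qed
  \<comment> \<open>The summand 1 is the power with exponent 0.\<close>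
  have sum_eq: "1 + (\<Sum>v = 1..r - 1. (real k / real n) ^ v) = (\<Sum>i<r. (real k / real n) ^ i)"
  proof -
    have "{..<r} = insert 0 {1..r - 1}" using r by auto
    then show ?thesis by simp
  qed
  have "plc_rate G V P v \<le> ennreal (1 / (\<Sum>i<r. (real k / real n) ^ i))"
    if P: "is_plc_protocol G V P" and v: "v < dim_row V" for P v
  proof -
    interpret plc_scheme G V n k f \<mu> P
      by unfold_locales (fact G assms(4) P n assms(2))+
    show ?thesis
      using rate_bound[of v] v k r assms(4,6) by simp
  qed
  then have "plc_capacity G V \<le> ennreal (1 / (\<Sum>i<r. (real k / real n) ^ i))"
    unfolding plc_capacity_def by (intro Sup_least) auto
  moreover have "1 / (\<Sum>i<r. (real k / real n) ^ i) = (1 - real k / real n) * inverse (1 - (real k / real n) ^ r)"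
    if "k < n"
  proof -
    have "real k / real n \<noteq> 1" using that by simp
    then have "(\<Sum>i<r. (real k / real n) ^ i) = (1 - (real k / real n) ^ r) / (1 - real k / real n)"
      by (simp only: sum_gp_strict if_False)
    moreover have "1 / (x / y) = y * inverse x" for x y :: real
      by (simp add: divide_inverse)
    ultimately show ?thesis by simp
  qed
  ultimately show ?thesis unfolding sum_eq by blast
qed

end
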